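(* Let $D$ be a hyperbolic digraph satisfying (B1) and (B2). Then the following hold. (i) If all vertices of $D$ have finite out-degree, then every quasi-geodesic f-boundary point contains a geodesic f-boundary point. (ii) If all vertices of $D$ have finite in-degree, then every quasi-geodesic b-boundary point contains a geodesic b-boundary point. (iii) If $D$ is locally finite, then every quasi-geodesic boundary point contains a geodesic boundary point.
   Context: Digraphs may have loops, parallel edges and oppositely oriented edges. A directed path in $D$ is a sequence $x_0\ldots x_n$ of vertices with every $x_ix_{i+1}$ an edge; its length $\ell$ is $n$. $d(x,y)$ is the length of a shortest directed path from $x$ to $y$, or $\infty$ if there is none. $D$ is regarded as the semimetric space $(V(D),d)$ with these directed paths; a directed path from $x$ to $y$ is a geodesic if its length is $d(x,y)$. The out-degree (in-degree) of $x$ is the number of $y$ with $d(x,y)=1$ ($d(y,x)=1$); $D$ is locally finite if all in- and out-degrees are finite. $\mathcal B^+_r(x)=\{y: d(x,y)\le r\}$, $\mathcal B^-_r(x)=\{y:d(y,x)\le r\}$, and $\mathcal B^\pm_r(Y)=\bigcup_{y\in Y}\mathcal B^\pm_r(y)$. A geodesic triangle consists of three points and three geodesics (its sides), one between every two of these points (in one of the two directions). It is $\delta$-thin if for every labelling $P,Q,R$ of its sides such that the starting point of $P$ is the starting or the end point of $Q$ and the end point of $P$ is the starting or the end point of $R$, we have $P\subseteq\mathcal B^+_\delta(Q)\cup\mathcal B^-_\delta(R)$. $D$ is hyperbolic if for some $\delta\ge0$ all geodesic triangles are $\delta$-thin. (B1): there is $f\colon\mathbb R\to\mathbb R$ such that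 for all $x$, $r\ge0$ and $y,z\in\mathcal B^+_r(x)$, $d(y,z)$ is either $\infty$ or at most $f(r)$. (B2): the same with $\mathcal B^-_r(x)$ in place of $\mathcal B^+_r(x)$. A ray is a sequence $x_0x_1\ldots$ of distinct vertices with edges $x_ix_{i+1}$; an anti-ray is such a sequence with edges $x_{i+1}x_i$. A directed path $P$ is a $(\gamma,c)$-quasi-geodesic ($\gamma\ge1,c\ge0$) if $\ell(uPv)\le\gamma d(u,v)+c$ for every directed subpath $uPv$ of $P$ from $u$ to $v$. A (anti-)ray is geodesic (quasi-geodesic) if all its finite directed subpaths are geodesics (are $(\gamma,c)$-quasi-geodesics for fixed constants $\gamma,c$). For quasi-geodesic rays or anti-rays $R_1,R_2$ write $R_1\le R_2$ if there is $M\ge0$ such that for every $r\ge0$ and every $x$ there is a directed path from $R_1$ to $R_2$ of length at most $M$ outside of $\mathcal B^+_r(x)\cup\mathcal B^-_r(x)$; write $R_1\approx R_2$ if $R_1\le R_2\le R_1$. Under the hypotheses $\le$ is a quasiorder, so $\approx$ is an equivalence relation. Quasi-geodesic boundary points are the $\approx$-classes of quasi-geodesic rays and anti-rays; quasi-geodesic f-boundary points (b-boundary points) are the classes of $\approx$ restricted to quasi-geodesic rays (anti-rays). Geodesic boundary points, f-boundary points and b-boundary points are the classes of $\approx$ restricted to geodesic rays and anti-rays, geodesic rays, and geodesic anti-rays, respectively. "Contains" means set inclusion. *)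

theory Defs
  imports
    "Graph_Theory.Vertex_Walk"
    "HOL-Library.Extended_Real"
    "HOL-Library.Multiset"
    "HOL-Library.Sublist"
begin

text \<open>
  Digraphs are the \<^typ>\<open>('a, 'b) pre_digraph\<close>s satisfying \<^const>\<open>wf_digraph\<close>: they may be
  infinite and may have loops, parallel and oppositely oriented arcs. Directed paths are vertex
  sequences, i.e. \<^const>\<open>vwalk\<close>s; vertices may repeat. Only geodesics, rays and anti-rays are
  necessarily free of repetitions.
\<close>

subsection \<open>The semimetric of a digraph\<close>

text \<open>The infimum over the empty set is \<open>\<infinity>\<close>.\<close>

definition ddist :: "('a, 'b) pre_digraph \<Rightarrow> 'a \<Rightarrow> 'a \<Rightarrow> enat" where
  "ddist D x y = (INF p \<in> {p. vwalk p D \<and> hd p = x \<and> last p = y}. enat (vwalk_length p))"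

definition out_ball :: "('a, 'b) pre_digraph \<Rightarrow> real \<Rightarrow> 'a \<Rightarrow> 'a set" where
  "out_ball D r x = {y \<in> verts D. ereal_of_enat (ddist D x y) \<le> ereal r}"

definition in_ball :: "('a, 'b) pre_digraph \<Rightarrow> real \<Rightarrow> 'a \<Rightarrow> 'a set" where
  "in_ball D r x = {y \<in> verts D. ereal_of_enat (ddist D y x) \<le> ereal r}"

text \<open>
  Degrees count neighbours at distance 1, so loops and multiplicities of arcs do not matter; the
  library's \<^const>\<open>out_degree\<close> and \<^const>\<open>in_degree\<close> count arcs instead.
\<close>

definition finite_out_degrees :: "('a, 'b) pre_digraph \<Rightarrow> bool" where
  "finite_out_degrees D \<longleftrightarrow> (\<forall>x\<in>verts D. finite {y \<in> verts D. ddist D x y = 1})"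

definition finite_in_degrees :: "('a, 'b) pre_digraph \<Rightarrow> bool" where
  "finite_in_degrees D \<longleftrightarrow> (\<forall>x\<in>verts D. finite {y \<in> verts D. ddist D y x = 1})"

definition locally_finite_digraph :: "('a, 'b) pre_digraph \<Rightarrow> bool" where
  "locally_finite_digraph D \<longleftrightarrow> finite_out_degrees D \<and> finite_in_degrees D"

definition B1 :: "('a, 'b) pre_digraph \<Rightarrow> bool" where
  "B1 D \<longleftrightarrow> (\<exists>f :: real \<Rightarrow> real. \<forall>x\<in>verts D. \<forall>r\<ge>0. \<forall>y\<in>out_ball D r x. \<forall>z\<in>out_ball D r x.
     ddist D y z = \<infinity> \<or> ereal_of_enat (ddist D y z) \<le> ereal (f r))"

definition B2 :: "('a, 'b) pre_digraph \<Rightarrow> bool" where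
  "B2 D \<longleftrightarrow> (\<exists>f :: real \<Rightarrow> real. \<forall>x\<in>verts D. \<forall>r\<ge>0. \<forall>y\<in>in_ball D r x. \<forall>z\<in>in_ball D r x.
     ddist D y z = \<infinity> \<or> ereal_of_enat (ddist D y z) \<le> ereal (f r))"

subsection \<open>Geodesics and hyperbolicity\<close>

definition geodesic :: "('a, 'b) pre_digraph \<Rightarrow> 'a list \<Rightarrow> bool" where
  "geodesic D p \<longleftrightarrow> vwalk p D \<and> enat (vwalk_length p) = ddist D (hd p) (last p)"

text \<open>Each side runs in one of the two possible directions; corners may coincide.\<close>

definition geodesic_triangle ::
  "('a, 'b) pre_digraph \<Rightarrow> 'a list \<Rightarrow> 'a list \<Rightarrow> 'a list \<Rightarrow> bool" where
  "geodesic_triangle D A B C \<longleftrightarrow>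
     geodesic D A \<and> geodesic D B \<and> geodesic D C \<and>
     (\<exists>x y z. {hd A, last A} = {x, y} \<and> {hd B, last B} = {y, z} \<and> {hd C, last C} = {z, x})"

text \<open>The multiset equation says that \<open>P\<close>, \<open>Q\<close>, \<open>R\<close> is a relabelling of \<open>A\<close>, \<open>B\<close>, \<open>C\<close>.\<close>

definition thin_triangle ::
  "('a, 'b) pre_digraph \<Rightarrow> real \<Rightarrow> 'a list \<Rightarrow> 'a list \<Rightarrow> 'a list \<Rightarrow> bool" where
  "thin_triangle D \<delta> A B C \<longleftrightarrow>
     (\<forall>P Q R. {#P, Q, R#} = {#A, B, C#} \<and> hd P \<in> {hd Q, last Q} \<and> last P \<in> {hd R, last R} \<longrightarrow>
        set P \<subseteq> (\<Union>q\<in>set Q. out_ball D \<delta> q) \<union> (\<Union>q\<in>set R. in_ball D \<delta> q))"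

definition hyperbolic_digraph :: "('a, 'b) pre_digraph \<Rightarrow> bool" where
  "hyperbolic_digraph D \<longleftrightarrow>
     (\<exists>\<delta>\<ge>0. \<forall>A B C. geodesic_triangle D A B C \<longrightarrow> thin_triangle D \<delta> A B C)"

definition quasi_geodesic :: "('a, 'b) pre_digraph \<Rightarrow> real \<Rightarrow> real \<Rightarrow> 'a list \<Rightarrow> bool" where
  "quasi_geodesic D \<gamma> c p \<longleftrightarrow> vwalk p D \<and>
     (\<forall>q. sublist q p \<and> q \<noteq> [] \<longrightarrow>
        ereal (real (vwalk_length q)) \<le>
          ereal \<gamma> * ereal_of_enat (ddist D (hd q) (last q)) + ereal c)"

subsection \<open>Rays and anti-rays\<close>

definition ray :: "('a, 'b) pre_digraph \<Rightarrow> (nat \<Rightarrow> 'a) \<Rightarrow> bool" where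
  "ray D X \<longleftrightarrow> inj X \<and> range X \<subseteq> verts D \<and> (\<forall>i. X i \<rightarrow>\<^bsub>D\<^esub> X (Suc i))"

definition anti_ray :: "('a, 'b) pre_digraph \<Rightarrow> (nat \<Rightarrow> 'a) \<Rightarrow> bool" where
  "anti_ray D X \<longleftrightarrow> inj X \<and> range X \<subseteq> verts D \<and> (\<forall>i. X (Suc i) \<rightarrow>\<^bsub>D\<^esub> X i)"

text \<open>
  The finite directed subpaths of a ray \<open>X\<close> are the segments from \<open>X i\<close> to \<open>X j\<close> with \<open>i \<le> j\<close>;
  those of an anti-ray are the reversed segments, from \<open>X j\<close> to \<open>X i\<close>.
\<close>

definition segment :: "(nat \<Rightarrow> 'a) \<Rightarrow> nat \<Rightarrow> nat \<Rightarrow> 'a list" where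
  "segment X i j = map X [i..<Suc j]"

definition geodesic_ray :: "('a, 'b) pre_digraph \<Rightarrow> (nat \<Rightarrow> 'a) \<Rightarrow> bool" where
  "geodesic_ray D X \<longleftrightarrow> ray D X \<and> (\<forall>i j. i \<le> j \<longrightarrow> geodesic D (segment X i j))"

definition geodesic_anti_ray :: "('a, 'b) pre_digraph \<Rightarrow> (nat \<Rightarrow> 'a) \<Rightarrow> bool" where
  "geodesic_anti_ray D X \<longleftrightarrow>
     anti_ray D X \<and> (\<forall>i j. i \<le> j \<longrightarrow> geodesic D (rev (segment X i j)))"

definition quasi_geodesic_ray :: "('a, 'b) pre_digraph \<Rightarrow> (nat \<Rightarrow> 'a) \<Rightarrow> bool" where
  "quasi_geodesic_ray D X \<longleftrightarrow> ray D X \<and>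
     (\<exists>\<gamma>\<ge>1. \<exists>c\<ge>0. \<forall>i j. i \<le> j \<longrightarrow> quasi_geodesic D \<gamma> c (segment X i j))"

definition quasi_geodesic_anti_ray :: "('a, 'b) pre_digraph \<Rightarrow> (nat \<Rightarrow> 'a) \<Rightarrow> bool" where
  "quasi_geodesic_anti_ray D X \<longleftrightarrow> anti_ray D X \<and>
     (\<exists>\<gamma>\<ge>1. \<exists>c\<ge>0. \<forall>i j. i \<le> j \<longrightarrow> quasi_geodesic D \<gamma> c (rev (segment X i j)))"

subsection \<open>Boundary points\<close>

definition ray_le :: "('a, 'b) pre_digraph \<Rightarrow> (nat \<Rightarrow> 'a) \<Rightarrow> (nat \<Rightarrow> 'a) \<Rightarrow> bool" where
  "ray_le D X Y \<longleftrightarrow>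
     (\<exists>M::real\<ge>0. \<forall>r\<ge>0. \<forall>x\<in>verts D.
        \<exists>p. vwalk p D \<and> hd p \<in> range X \<and> last p \<in> range Y \<and> real (vwalk_length p) \<le> M \<and>
            set p \<inter> (out_ball D r x \<union> in_ball D r x) = {})"

text \<open>
  \<open>ray_equiv_on D S\<close> is the relation \<open>\<approx>\<close> restricted to \<open>S\<close>, and the boundary points are its
  classes, formed with the library's quotient \<open>S // r\<close>.
\<close>

definition ray_equiv_on ::
  "('a, 'b) pre_digraph \<Rightarrow> (nat \<Rightarrow> 'a) set \<Rightarrow> ((nat \<Rightarrow> 'a) \<times> (nat \<Rightarrow> 'a)) set" where
  "ray_equiv_on D S = {(X, Y). X \<in> S \<and> Y \<in> S \<and> ray_le D X Y \<and> ray_le D Y X}"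

definition boundary_points_of ::
  "('a, 'b) pre_digraph \<Rightarrow> (nat \<Rightarrow> 'a) set \<Rightarrow> (nat \<Rightarrow> 'a) set set" where
  "boundary_points_of D S = S // ray_equiv_on D S"

definition quasi_geodesic_f_boundary :: "('a, 'b) pre_digraph \<Rightarrow> (nat \<Rightarrow> 'a) set set" where
  "quasi_geodesic_f_boundary D = boundary_points_of D {X. quasi_geodesic_ray D X}"

definition quasi_geodesic_b_boundary :: "('a, 'b) pre_digraph \<Rightarrow> (nat \<Rightarrow> 'a) set set" where
  "quasi_geodesic_b_boundary D = boundary_points_of D {X. quasi_geodesic_anti_ray D X}"

definition quasi_geodesic_boundary :: "('a, 'b) pre_digraph \<Rightarrow> (nat \<Rightarrow> 'a) set set" where
  "quasi_geodesic_boundary D =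
     boundary_points_of D {X. quasi_geodesic_ray D X \<or> quasi_geodesic_anti_ray D X}"

definition geodesic_f_boundary :: "('a, 'b) pre_digraph \<Rightarrow> (nat \<Rightarrow> 'a) set set" where
  "geodesic_f_boundary D = boundary_points_of D {X. geodesic_ray D X}"

definition geodesic_b_boundary :: "('a, 'b) pre_digraph \<Rightarrow> (nat \<Rightarrow> 'a) set set" where
  "geodesic_b_boundary D = boundary_points_of D {X. geodesic_anti_ray D X}"

definition geodesic_boundary :: "('a, 'b) pre_digraph \<Rightarrow> (nat \<Rightarrow> 'a) set set" where
  "geodesic_boundary D = boundary_points_of D {X. geodesic_ray D X \<or> geodesic_anti_ray D X}"

end

theory Submission
  imports Defs
begin

text \<open>
  Hyperbolicity, (B1) and (B2) depend only on the relations \<open>d(x, y) \<le> k\<close>, that is, on the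
  adjacency relation \<open>R\<close> of the digraph. They are also invariant under reversing all arcs
  (\<open>converse_thin_relation\<close>), which turns rays into anti-rays. So it suffices to argue over a
  binary relation, with paths that leave a given point and along rays.

  The heart of the matter is that a geodesic \<open>Q\<close> stays within a bounded distance, in both
  directions, of any quasi-geodesic \<open>P\<close> with the same ends (\<open>geod_close_to_quasi_geod\<close>). As in
  the undirected Morse lemma, a geodesic is within logarithmic distance of any walk with the
  same ends (\<open>geod_near_walk\<close>); and if \<open>D\<close> is the largest distance of a point of \<open>Q\<close> from \<open>P\<close>,
  a detour around such a point over a piece of \<open>P\<close> of length linear in \<open>D\<close> shows that \<open>D\<close> is
  at most logarithmic in itself (\<open>morse_step\<close>). Two difficulties are specific to digraphs.
  First, (B1) and (B2) allow an arbitrary function of the radius, where the comparison of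
  scales needs a linear one; thin triangles with two sides of length at most \<open>m\<close> show that a
  linear function always suffices (\<open>linear_B1\<close>). Second, thinness yields only paths in one
  direction, depending on the side that is met, and two points with short paths from a common
  point need not be joined at all. This is overcome by moving a bounded distance along a
  geodesic before applying thinness (\<open>geod_backtrack\<close>, \<open>long_side\<close>, \<open>quadrilateral\<close>).

  For a quasi-geodesic ray \<open>X\<close> in a digraph with finite out-degrees, geodesics from \<open>X 0\<close> to
  \<open>X n\<close> have a geodesic ray \<open>G\<close> as a limit, and every point of \<open>G\<close> has short paths from and to
  \<open>X\<close> (\<open>ex_geod_ray\<close>). Since quasi-geodesic rays and anti-rays leave every ball, \<open>ray_le\<close> just
  says that there are paths of bounded length between arbitrarily late points
  (\<open>ray_le_iff_linked\<close>). Hence every ray or anti-ray equivalent to \<open>G\<close> is equivalent to \<open>X\<close>,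
  so the geodesic boundary point of \<open>G\<close> is contained in the quasi-geodesic one of \<open>X\<close>
  (\<open>boundary_points_contain\<close>).
\<close>

section \<open>Bounded distance, walks and geodesics in a relation\<close>

text \<open>
  The relation \<open>d(x, y) \<le> k\<close>. Working with this relation instead of the extended-number-valued
  semimetric keeps all estimates in the natural numbers and turns reversal of the digraph into
  passing to \<open>R\<inverse>\<close>.
\<close>

definition near :: "'a rel \<Rightarrow> nat \<Rightarrow> 'a \<Rightarrow> 'a \<Rightarrow> bool" where
  "near R k x y \<longleftrightarrow> (\<exists>n\<le>k. (x, y) \<in> R ^^ n)"

text \<open>
  Walks and geodesics are index functions with a separate length, so that position along a
  path is index arithmetic; the values beyond index \<open>n\<close> are arbitrary.
\<close>

definition walk :: "'a rel \<Rightarrow> (nat \<Rightarrow> 'a) \<Rightarrow> nat \<Rightarrow> bool" where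
  "walk R w n \<longleftrightarrow> (\<forall>i<n. (w i, w (Suc i)) \<in> R)"

definition geod :: "'a rel \<Rightarrow> (nat \<Rightarrow> 'a) \<Rightarrow> nat \<Rightarrow> bool" where
  "geod R g n \<longleftrightarrow> walk R g n \<and> (\<forall>i j k. i \<le> j \<longrightarrow> j \<le> n \<longrightarrow> near R k (g i) (g j) \<longrightarrow> j - i \<le> k)"

lemma near_refl [simp]: "near R k x x"
  unfolding near_def by (rule exI[of _ 0]) auto

lemma near_mono: "near R j x y \<Longrightarrow> j \<le> k \<Longrightarrow> near R k x y"
  unfolding near_def by (meson le_trans)

lemma near_trans: "near R j x y \<Longrightarrow> near R k y z \<Longrightarrow> near R (j + k) x z"
  unfolding near_def by (meson add_mono relpow_trans)

lemma near_trans_le: "near R j x y \<Longrightarrow> near R k y z \<Longrightarrow> j + k \<le> l \<Longrightarrow> near R l x z"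
  using near_trans near_mono by metis

lemma near_imp_reachable: "near R k x y \<Longrightarrow> (x, y) \<in> R\<^sup>*"
  unfolding near_def by (meson relpow_imp_rtrancl)

lemma reachable_imp_near: "(x, y) \<in> R\<^sup>* \<Longrightarrow> \<exists>k. near R k x y"
  unfolding near_def by (meson order_refl rtrancl_imp_relpow)

lemma near_0: "near R 0 x y \<longleftrightarrow> x = y"
  unfolding near_def by auto

lemma walk_near:
  assumes "walk R w n" "i \<le> j" "j \<le> n"
  shows "near R (j - i) (w i) (w j)"
proof -
  have "\<exists>f. f 0 = w i \<and> f (j - i) = w j \<and> (\<forall>k<j - i. (f k, f (Suc k)) \<in> R)"
    using assms unfolding walk_def by (intro exI[of _ "\<lambda>k. w (i + k)"]) auto
  then have "(w i, w j) \<in> R ^^ (j - i)"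
    by (simp add: relpow_fun_conv)
  then show ?thesis unfolding near_def by blast
qed

lemma walk_reachable: "walk R w n \<Longrightarrow> i \<le> j \<Longrightarrow> j \<le> n \<Longrightarrow> (w i, w j) \<in> R\<^sup>*"
  by (meson near_imp_reachable walk_near)

lemma near_iff_walk: "near R k x y \<longleftrightarrow> (\<exists>w n. walk R w n \<and> n \<le> k \<and> w 0 = x \<and> w n = y)"
  unfolding near_def relpow_fun_conv walk_def by blast

lemma walk_sub: "walk R w n \<Longrightarrow> i \<le> j \<Longrightarrow> j \<le> n \<Longrightarrow> walk R (\<lambda>k. w (i + k)) (j - i)"
  unfolding walk_def by auto

lemma walk_converse:
  assumes W: "walk R w n" shows "walk (R\<inverse>) (\<lambda>i. w (n - i)) n"
  unfolding walk_def
proof (intro allI impI)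
  fix i assume i: "i < n"
  then have "(w (n - Suc i), w (Suc (n - Suc i))) \<in> R"
    using W unfolding walk_def by auto
  moreover have "Suc (n - Suc i) = n - i" using i by auto
  ultimately show "(w (n - i), w (n - Suc i)) \<in> R\<inverse>" by simp
qed

lemma near_converse: "near (R\<inverse>) k x y \<longleftrightarrow> near R k y x"
proof -
  have *: "near (S\<inverse>) k u v" if vu: "near S k v u" for S :: "'a rel" and u v
  proof -
    obtain w n where "walk S w n" "n \<le> k" "w 0 = v" "w n = u"
      using vu unfolding near_iff_walk by blast
    then show ?thesis unfolding near_iff_walk
      by (intro exI[of _ "\<lambda>i. w (n - i)"] exI[of _ n]) (simp add: walk_converse)
  qed
  from *[of R y x] *[of "R\<inverse>" x y] show ?thesis by auto
qed

lemma geodD: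
  assumes "geod R g n" "i \<le> j" "j \<le> n" "near R k (g i) (g j)" shows "j \<le> i + k"
proof -
  have "j - i \<le> k" using assms unfolding geod_def by blast
  then show ?thesis by simp
qed

lemma geod_walk: "geod R g n \<Longrightarrow> walk R g n"
  unfolding geod_def by simp

lemma geod_near: "geod R g n \<Longrightarrow> i \<le> j \<Longrightarrow> j \<le> n \<Longrightarrow> near R (j - i) (g i) (g j)"
  by (rule walk_near[OF geod_walk])

lemma geod_reachable: "geod R g n \<Longrightarrow> i \<le> j \<Longrightarrow> j \<le> n \<Longrightarrow> (g i, g j) \<in> R\<^sup>*"
  by (rule walk_reachable[OF geod_walk])

lemma geod_sub:
  assumes "geod R g n" "i \<le> j" "j \<le> n" shows "geod R (\<lambda>k. g (i + k)) (j - i)"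
  unfolding geod_def
proof (intro conjI allI impI)
  show "walk R (\<lambda>k. g (i + k)) (j - i)" using assms geod_walk walk_sub by metis
  fix a b k assume ab: "a \<le> b" "b \<le> j - i" "near R k (g (i + a)) (g (i + b))"
  then have "i + b \<le> i + a + k"
    using assms by (intro geodD[OF assms(1) _ _ ab(3)]) auto
  then show "b - a \<le> k" by simp
qed

lemma geod_trivial: "geod R (\<lambda>_. x) 0"
  unfolding geod_def walk_def by simp

lemma shortest_walk_geod:
  assumes w: "walk R w n" and min: "\<And>k. near R k (w 0) (w n) \<Longrightarrow> n \<le> k"
  shows "geod R w n"
  unfolding geod_def
proof (intro conjI allI impI)
  fix i j k assume ij: "i \<le> j" "j \<le> n" "near R k (w i) (w j)"
  have "near R (i - 0) (w 0) (w i)" "near R (n - j) (w j) (w n)"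
    using w ij by (auto intro: walk_near[of R w n 0 i, simplified] walk_near)
  then have "near R (i + k + (n - j)) (w 0) (w n)"
    using ij(3) near_trans by (metis diff_zero)
  from min[OF this] show "j - i \<le> k" using ij by simp
qed (fact w)

lemma ex_geod:
  assumes "(x, y) \<in> R\<^sup>*"
  obtains g n where "geod R g n" "g 0 = x" "g n = y"
proof -
  define n where "n = (LEAST k. near R k x y)"
  have n: "near R n x y"
    unfolding n_def using reachable_imp_near[OF assms] by (metis LeastI)
  have min: "n \<le> k" if "near R k x y" for k
    unfolding n_def using that by (rule Least_le)
  obtain w m where w: "walk R w m" "m \<le> n" "w 0 = x" "w m = y"
    using n unfolding near_iff_walk by auto
  have "near R m x y" unfolding near_iff_walk using w by blast
  then have "m = n" using min w by (simp add: le_antisym)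
  then have "geod R w m" using w min by (intro shortest_walk_geod) auto
  then show ?thesis using that w by blast
qed

lemma geod_length_le: "geod R g n \<Longrightarrow> near R k (g 0) (g n) \<Longrightarrow> n \<le> k"
  using geodD[of R g n 0 n k] by simp

lemma geod_cong:
  assumes eq: "\<And>i. i \<le> n \<Longrightarrow> g i = h i" and g: "geod R g n" shows "geod R h n"
proof (rule shortest_walk_geod)
  show "walk R h n"
    unfolding walk_def
  proof (intro allI impI)
    fix i assume "i < n"
    then show "(h i, h (Suc i)) \<in> R"
      using geod_walk[OF g] eq[of i] eq[of "Suc i"] unfolding walk_def by fastforce
  qed
  show "n \<le> k" if "near R k (h 0) (h n)" for k
    using geod_length_le[OF g, of k] eq[of 0] eq[of n] that by simp
qed

lemma geod_inj:
  assumes "\<And>n. geod R X n" shows "inj X"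
proof (rule linorder_injI)
  fix i j :: nat assume "i < j"
  then show "X i \<noteq> X j" using geodD[OF assms, of i j j 0] by (auto simp: near_0)
qed

lemma geod_converse:
  assumes g: "geod R g n" shows "geod (R\<inverse>) (\<lambda>i. g (n - i)) n"
proof (rule shortest_walk_geod)
  show "walk (R\<inverse>) (\<lambda>i. g (n - i)) n"
    by (rule walk_converse[OF geod_walk[OF g]])
  fix k assume "near (R\<inverse>) k (g (n - 0)) (g (n - n))"
  then have "near R k (g 0) (g n)" by (simp add: near_converse)
  then show "n \<le> k" by (rule geod_length_le[OF g])
qed

section \<open>Thin triangles and linear ball conditions\<close>

text \<open>
  Used for indices along a geodesic: the points within bounded distance of a fixed point
  occupy a window of bounded length.
\<close>

lemma card_window:
  fixes A :: "nat set"
  assumes "\<And>i j. i \<in> A \<Longrightarrow> j \<in> A \<Longrightarrow> i \<le> j \<Longrightarrow> j \<le> i + c"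
  shows "card A \<le> c + 1" "finite A"
proof -
  have "A \<subseteq> {(LEAST a. a \<in> A)..(LEAST a. a \<in> A) + c}"
  proof
    fix x assume x: "x \<in> A"
    then have "(LEAST a. a \<in> A) \<in> A" "(LEAST a. a \<in> A) \<le> x" by (auto intro: LeastI Least_le)
    then show "x \<in> {(LEAST a. a \<in> A)..(LEAST a. a \<in> A) + c}" using assms x by auto
  qed
  then show "finite A" "card A \<le> c + 1"
    using finite_subset card_mono[of "{(LEAST a. a \<in> A)..(LEAST a. a \<in> A) + c}" A] by auto
qed

text \<open>
  The vertices of a digraph that satisfies hyperbolicity, (B1) and (B2), seen through its
  adjacency relation only. In \<open>thin\<close>, the side \<open>Q\<close> meets \<open>P\<close> at its start and \<open>S\<close> meets it at
  its end; both run in an arbitrary direction, and \<open>z\<close> is the corner opposite to \<open>P\<close>. One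
  function \<open>f\<close> serves both ball conditions, which makes the hypotheses literally symmetric
  under reversal.
\<close>

locale thin_relation =
  fixes R :: "'a rel" and \<delta> :: nat and f :: "nat \<Rightarrow> nat"
  assumes thin: "\<lbrakk>geod R P p; geod R Q q; geod R S s; {Q 0, Q q} = {P 0, z}; {S 0, S s} = {P p, z}; i \<le> p\<rbrakk>
      \<Longrightarrow> (\<exists>j\<le>q. near R \<delta> (Q j) (P i)) \<or> (\<exists>j\<le>s. near R \<delta> (P i) (S j))"
    and B1: "\<lbrakk>near R r x y; near R r x z; (y, z) \<in> R\<^sup>*\<rbrakk> \<Longrightarrow> near R (f r) y z"
    and B2: "\<lbrakk>near R r y x; near R r z x; (y, z) \<in> R\<^sup>*\<rbrakk> \<Longrightarrow> near R (f r) y z"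
begin

text \<open>
  Reversal exchanges the start and the end of \<open>P\<close>, and hence the two sides meeting it, and at
  the same time exchanges out-balls and in-balls; these two changes cancel in \<open>thin\<close>. The two
  ball conditions are exchanged.
\<close>

lemma converse_thin_relation: "thin_relation (R\<inverse>) \<delta> f"
proof
  fix P Q S :: "nat \<Rightarrow> 'a" and p q s z i
  assume *: "geod (R\<inverse>) P p" "geod (R\<inverse>) Q q" "geod (R\<inverse>) S s"
    "{Q 0, Q q} = {P 0, z}" "{S 0, S s} = {P p, z}" "i \<le> p"
  have "(\<exists>j\<le>s. near R \<delta> (S (s - j)) (P (p - (p - i)))) \<or> (\<exists>j\<le>q. near R \<delta> (P (p - (p - i))) (Q (q - j)))"
    by (rule thin[of "\<lambda>i. P (p - i)" p "\<lambda>i. S (s - i)" s "\<lambda>i. Q (q - i)" q z "p - i"])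
       (use * geod_converse[of "R\<inverse>"] in \<open>auto simp: insert_commute\<close>)
  then show "(\<exists>j\<le>q. near (R\<inverse>) \<delta> (Q j) (P i)) \<or> (\<exists>j\<le>s. near (R\<inverse>) \<delta> (P i) (S j))"
    using * by (auto simp: near_converse)
next
  fix r x y z
  assume "near (R\<inverse>) r x y" "near (R\<inverse>) r x z" "(y, z) \<in> (R\<inverse>)\<^sup>*"
  then show "near (R\<inverse>) (f r) y z"
    using B2 by (simp add: near_converse rtrancl_converse)
next
  fix r x y z
  assume "near (R\<inverse>) r y x" "near (R\<inverse>) r z x" "(y, z) \<in> (R\<inverse>)\<^sup>*"
  then show "near (R\<inverse>) (f r) y z"
    using B1 by (simp add: near_converse rtrancl_converse)
qed

text \<open>
  A linear function that can replace \<open>f\<close>; it depends only on \<open>\<delta>\<close> and \<open>f \<delta>\<close>.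
\<close>

definition spread :: "nat \<Rightarrow> nat" where
  "spread m = 2 * (f \<delta> + 1) * (m + 1)"

lemma spread_mono: "m \<le> n \<Longrightarrow> spread m \<le> spread n"
  unfolding spread_def by (rule mult_le_mono2) simp

lemma le_spread: "m \<le> spread m"
  unfolding spread_def by simp

text \<open>
  (B1) allows an arbitrary function \<open>f\<close>, but the scale comparison in the stability theorem
  needs constants that grow linearly. In the thin triangle \<open>x\<close>, \<open>y\<close>, \<open>z\<close> each point of the
  side from \<open>y\<close> to \<open>z\<close> is tied to one of the at most \<open>2 (m + 1)\<close> points of the other two
  sides. By the ball conditions at radius \<open>\<delta>\<close>, each of those points serves at most \<open>f \<delta> + 1\<close>
  points of the geodesic from \<open>y\<close> to \<open>z\<close>, which bounds its length.
\<close>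

lemma linear_B1:
  assumes xy: "near R m x y" and xz: "near R m x z" and yz: "(y, z) \<in> R\<^sup>*"
  shows "near R (spread m) y z"
proof -
  obtain A a where A: "geod R A a" "A 0 = x" "A a = y"
    using ex_geod[OF near_imp_reachable[OF xy]] .
  obtain B b where B: "geod R B b" "B 0 = x" "B b = z"
    using ex_geod[OF near_imp_reachable[OF xz]] .
  obtain Q q where Q: "geod R Q q" "Q 0 = y" "Q q = z"
    using ex_geod[OF yz] .
  have am: "a \<le> m" and bm: "b \<le> m"
    using A B xy xz geod_length_le by metis+
  define U where "U i = {j. j \<le> q \<and> near R \<delta> (A i) (Q j)}" for i
  define V where "V i = {j. j \<le> q \<and> near R \<delta> (Q j) (B i)}" for i
  have U: "card (U i) \<le> f \<delta> + 1" "finite (U i)" for i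
  proof -
    have "j' \<le> j + f \<delta>" if "j \<in> U i" "j' \<in> U i" "j \<le> j'" for j j'
      using that B1[of \<delta> "A i" "Q j" "Q j'"] geod_reachable[OF Q(1)] geodD[OF Q(1), of j j' "f \<delta>"]
      by (simp add: U_def)
    then show "card (U i) \<le> f \<delta> + 1" "finite (U i)" by (rule card_window; blast)+
  qed
  have V: "card (V i) \<le> f \<delta> + 1" "finite (V i)" for i
  proof -
    have "j' \<le> j + f \<delta>" if "j \<in> V i" "j' \<in> V i" "j \<le> j'" for j j'
      using that B2[of \<delta> "Q j" "B i" "Q j'"] geod_reachable[OF Q(1)] geodD[OF Q(1), of j j' "f \<delta>"]
      by (simp add: V_def)
    then show "card (V i) \<le> f \<delta> + 1" "finite (V i)" by (rule card_window; blast)+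
  qed
  have "{..q} \<subseteq> (\<Union>i\<le>a. U i) \<union> (\<Union>i\<le>b. V i)"
  proof
    fix j assume "j \<in> {..q}"
    then have "(\<exists>i\<le>a. near R \<delta> (A i) (Q j)) \<or> (\<exists>i\<le>b. near R \<delta> (Q j) (B i))"
      by (intro thin[OF Q(1) A(1) B(1), of x]) (use A B Q in auto)
    then show "j \<in> (\<Union>i\<le>a. U i) \<union> (\<Union>i\<le>b. V i)"
      using \<open>j \<in> {..q}\<close> by (auto simp: U_def V_def)
  qed
  then have "card {..q} \<le> card ((\<Union>i\<le>a. U i) \<union> (\<Union>i\<le>b. V i))"
    using U V by (intro card_mono) auto
  also have "\<dots> \<le> card (\<Union>i\<le>a. U i) + card (\<Union>i\<le>b. V i)"
    by (rule card_Un_le)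
  also have "\<dots> \<le> (\<Sum>i\<le>a. card (U i)) + (\<Sum>i\<le>b. card (V i))"
    by (intro add_mono card_UN_le) auto
  also have "\<dots> \<le> (\<Sum>i\<le>a. f \<delta> + 1) + (\<Sum>i\<le>b. f \<delta> + 1)"
    by (intro add_mono sum_mono U V)
  also have "\<dots> = (a + 1 + (b + 1)) * (f \<delta> + 1)"
    by (simp add: algebra_simps)
  also have "\<dots> \<le> (2 * (m + 1)) * (f \<delta> + 1)"
    using am bm by (intro mult_right_mono) auto
  also have "\<dots> = spread m"
    unfolding spread_def by (simp add: algebra_simps)
  finally have "q \<le> spread m" by simp
  then show ?thesis
    using geod_near[OF Q(1), of 0 q] Q near_mono by fastforce
qed

lemma linear_B2:
  assumes "near R m y x" "near R m z x" "(y, z) \<in> R\<^sup>*"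
  shows "near R (spread m) y z"
proof -
  interpret C: thin_relation "R\<inverse>" \<delta> f by (rule converse_thin_relation)
  have "near (R\<inverse>) (C.spread m) z y"
    using assms by (intro C.linear_B1[of _ x]) (auto simp: near_converse rtrancl_converse)
  then show ?thesis by (simp add: near_converse C.spread_def spread_def)
qed

section \<open>Triangles and quadrilaterals\<close>

text \<open>
  Inside a strongly connected component the semimetric is symmetric up to a linear factor.
\<close>

lemma near_back:
  assumes "near R m x y" "(y, x) \<in> R\<^sup>*" shows "near R (spread m) y x"
  using linear_B1[of m x y x] assms by simp

text \<open>
  Thinness produces points of a geodesic with a short path \<^emph>\<open>to\<close> a given point of it,
  while the arguments below need short paths \<^emph>\<open>from\<close> a given point. The remedy is to
  apply thinness at a point \<open>m\<close> steps further on: a point with a path of length \<open>m\<close> to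
  \<open>U (s + m)\<close> cannot precede \<open>U s\<close>.
\<close>

lemma geod_backtrack:
  assumes U: "geod R U l" and "s + m \<le> l" "k \<le> l" and n: "near R m (U k) (U (s + m))"
  shows "near R (m + spread m) (U s) (U k)"
proof -
  have sk: "s \<le> k"
    using geodD[OF U _ _ n] assms by (cases "k \<le> s + m") auto
  show ?thesis
  proof (cases "k \<le> s + m")
    case True
    then show ?thesis using geod_near[OF U sk] assms by (auto intro: near_mono)
  next
    case False
    then have "near R (spread m) (U (s + m)) (U k)"
      using near_back[OF n] geod_reachable[OF U] assms by auto
    moreover have "near R m (U s) (U (s + m))"
      using geod_near[OF U, of s "s + m"] assms by auto
    ultimately show ?thesis by (rule near_trans[rotated])
  qed
qed

definition triangle_const :: nat where "triangle_const = 5 * \<delta> + spread (2 * \<delta>) + 1"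

text \<open>
  Thinness ties a point of \<open>Q\<close> either to \<open>B\<close> by a path that leaves it, which is what is
  wanted, or to \<open>A\<close> by a path that arrives at it. Let \<open>e\<close> be the last index of the second
  kind. Points after \<open>e\<close>, and points shortly before it, have a short path to \<open>B\<close>. For points
  far before \<open>e\<close>, thinness of the triangle cut off by the short path from \<open>A a'\<close> to \<open>Q e\<close> ties
  \<open>Q\<close> to \<open>A\<close> and \<open>A\<close> back to \<open>Q\<close>; \<open>geod_backtrack\<close> turns this round trip into a path from
  \<open>Q i\<close> to \<open>A\<close>.
\<close>

lemma long_side:
  assumes A: "geod R A a" and B: "geod R B b" and Q: "geod R Q q"
    and ends: "A 0 = Q 0" "A a = B 0" "B b = Q q" and i: "i \<le> q"
  shows "(\<exists>j\<le>a. near R triangle_const (Q i) (A j)) \<or> (\<exists>j\<le>b. near R triangle_const (Q i) (B j))"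
proof -
  define J where "J = {t. t \<le> q \<and> (\<exists>j\<le>a. near R \<delta> (A j) (Q t))}"
  define e where "e = Max J"
  have J: "finite J" "J \<noteq> {}"
    unfolding J_def using ends by (auto intro!: exI[of _ 0])
  then have "e \<in> J" unfolding e_def by simp
  then obtain a' where e: "e \<le> q" "a' \<le> a" "near R \<delta> (A a') (Q e)"
    unfolding J_def by auto
  have past: "\<exists>j\<le>b. near R \<delta> (Q t) (B j)" if "e < t" "t \<le> q" for t
  proof -
    have "t \<notin> J" using that J unfolding e_def by (meson Max_ge leD)
    moreover have "(\<exists>j\<le>a. near R \<delta> (A j) (Q t)) \<or> (\<exists>j\<le>b. near R \<delta> (Q t) (B j))"
      by (rule thin[OF Q A B, of "A a"]) (use ends that in auto)
    ultimately show ?thesis using that unfolding J_def by auto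
  qed
  have e_B: "\<exists>j\<le>b. near R (\<delta> + 1) (Q e) (B j)"
  proof (cases "e = q")
    case True
    then show ?thesis using ends by (auto intro!: exI[of _ b])
  next
    case False
    then obtain j where "j \<le> b" "near R \<delta> (Q (Suc e)) (B j)"
      using past[of "Suc e"] e by auto
    moreover have "near R 1 (Q e) (Q (Suc e))"
      using geod_near[OF Q, of e "Suc e"] e False by auto
    ultimately show ?thesis using near_trans_le[of R 1 "Q e" "Q (Suc e)" \<delta>] by auto
  qed
  have close_to_e: ?thesis if "near R (4 * \<delta> + spread (2 * \<delta>)) (Q i) (Q e)"
    using e_B that near_trans_le[of R _ "Q i" "Q e" "\<delta> + 1" _ triangle_const] unfolding triangle_const_def by fastforce
  \<comment> \<open>The head start by which a round trip of length \<open>2 * \<delta>\<close> through \<open>A\<close> still ends after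
    \<open>i\<close>.\<close>
  define j where "j = i + 2 * \<delta>"
  show ?thesis
  proof (cases "e < j")
    case True
    show ?thesis
    proof (cases "e < i")
      case True
      then show ?thesis using past[of i] i near_mono unfolding triangle_const_def by fastforce
    next
      case False
      then have "near R (e - i) (Q i) (Q e)" using geod_near[OF Q] e by simp
      then show ?thesis using True unfolding j_def by (intro close_to_e) (auto intro: near_mono)
    qed
  next
    case False
    then have je: "j \<le> e" by simp
    have ij: "near R (2 * \<delta>) (Q i) (Q j)"
      using geod_near[OF Q, of i j] e je unfolding j_def by auto
    obtain W w where W: "geod R W w" "W 0 = A a'" "W w = Q e"
      using ex_geod[OF near_imp_reachable[OF e(3)]] .
    have w\<delta>: "w \<le> \<delta>" using geod_length_le[OF W(1)] W e by simp
    have Qe: "geod R Q e" and Aa: "geod R A a'"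
      using geod_sub[OF Q, of 0 e] geod_sub[OF A, of 0 a'] e by auto
    have near_e: "near R \<delta> (W t) (Q e)" if "t \<le> w" for t
      using geod_near[OF W(1) that order_refl] W w\<delta> by (auto intro: near_mono)
    have "(\<exists>t\<le>a'. near R \<delta> (A t) (Q j)) \<or> (\<exists>t\<le>w. near R \<delta> (Q j) (W t))"
      by (rule thin[OF Qe Aa W(1), of "A a'"]) (use W ends je in auto)
    then show ?thesis
    proof (elim disjE exE conjE)
      fix t assume "t \<le> w" "near R \<delta> (Q j) (W t)"
      with near_e ij have "near R (2 * \<delta> + (\<delta> + \<delta>)) (Q i) (Q e)"
        by (meson near_trans)
      then show ?thesis by (intro close_to_e) (auto intro: near_mono)
    next
      fix t assume t: "t \<le> a'" "near R \<delta> (A t) (Q j)"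
      have "(\<exists>k\<le>e. near R \<delta> (Q k) (A t)) \<or> (\<exists>k\<le>w. near R \<delta> (A t) (W k))"
        by (rule thin[OF Aa Qe W(1), of "Q e"]) (use W ends t in auto)
      then show ?thesis
      proof (elim disjE exE conjE)
        fix k assume k: "k \<le> e" "near R \<delta> (Q k) (A t)"
        have "near R (2 * \<delta>) (Q k) (Q (i + 2 * \<delta>))"
          using near_trans[OF k(2) t(2)] unfolding j_def by (simp add: mult_2)
        then have "near R (2 * \<delta> + spread (2 * \<delta>)) (Q i) (Q k)"
          by (intro geod_backtrack[OF Qe]) (use je k in \<open>auto simp: j_def\<close>)
        with k have "near R triangle_const (Q i) (A t)"
          unfolding triangle_const_def by (elim near_trans_le) auto
        then show ?thesis using t e by auto
      next
        fix k assume "k \<le> w" "near R \<delta> (A t) (W k)"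
        with near_e have "near R (2 * \<delta>) (A t) (Q e)"
          using near_trans_le by (metis mult_2 order_refl)
        then have "near R (spread (2 * \<delta>)) (Q j) (Q e)"
          using linear_B1[of "2 * \<delta>" "A t" "Q j" "Q e"] t near_mono geod_reachable[OF Q je e(1)]
          by fastforce
        with ij show ?thesis by (intro close_to_e) (auto elim: near_trans_le)
      qed
    qed
  qed
qed

section \<open>Geodesics and walks with the same ends\<close>

text \<open>
  Halving the walk and applying \<open>long_side\<close> costs a constant per step, so the distance from a
  geodesic to a walk with the same ends is at most logarithmic in the length of the walk.
\<close>

lemma geod_near_walk:
  assumes "walk R w l" "geod R Q q" "Q 0 = w 0" "Q q = w l" "l \<le> 2 ^ n" "i \<le> q"
  shows "\<exists>j\<le>l. near R (triangle_const * n + 1) (Q i) (w j)"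
  using assms
proof (induction n arbitrary: w l Q q i)
  case 0
  have "near R (l - 0) (w 0) (w l)" by (rule walk_near[OF 0(1)]) auto
  then have "q \<le> l" using geod_length_le[OF 0(2)] 0 by simp
  then have "i = 0 \<or> i = q" using 0 by auto
  then show ?case using 0 by (auto intro: exI[of _ 0] exI[of _ l])
next
  case (Suc n)
  define m where "m = l div 2"
  have m: "m \<le> l" "m \<le> 2 ^ n" "l - m \<le> 2 ^ n" using Suc.prems unfolding m_def by auto
  have w: "walk R w m" "walk R (\<lambda>k. w (m + k)) (l - m)"
    using Suc.prems m walk_sub[of R w l 0 m] walk_sub[of R w l m l] by auto
  obtain A a where A: "geod R A a" "A 0 = w 0" "A a = w m"
    using ex_geod[OF walk_reachable[OF w(1), of 0 m]] by auto
  obtain B b where B: "geod R B b" "B 0 = w m" "B b = w l"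
    using ex_geod[OF walk_reachable[OF Suc.prems(1), of m l]] m by auto
  have "(\<exists>j\<le>a. near R triangle_const (Q i) (A j)) \<or> (\<exists>j\<le>b. near R triangle_const (Q i) (B j))"
    by (rule long_side[OF A(1) B(1) Suc.prems(2)]) (use A B Suc.prems in auto)
  then show ?case
  proof (elim disjE exE conjE)
    fix j assume j: "j \<le> a" "near R triangle_const (Q i) (A j)"
    then obtain k where k: "k \<le> m" "near R (triangle_const * n + 1) (A j) (w k)"
      using Suc.IH[OF w(1) A(1) A(2) A(3) m(2) j(1)] by auto
    show ?thesis using near_trans[OF j(2) k(2)] k(1) m by (auto intro!: exI[of _ k] simp: add.assoc)
  next
    fix j assume j: "j \<le> b" "near R triangle_const (Q i) (B j)"
    then obtain k where k: "k \<le> l - m" "near R (triangle_const * n + 1) (B j) (w (m + k))"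
      using Suc.IH[OF w(2) B(1) _ _ m(3) j(1)] B m by auto
    show ?thesis using near_trans[OF j(2) k(2)] k(1) m by (auto intro!: exI[of _ "m + k"] simp: add.assoc)
  qed
qed

text \<open>
  A geodesic from \<open>w 0\<close> to \<open>w l\<close> forms a degenerate triangle with \<open>H\<close>, which runs in the
  opposite direction. So \<open>H\<close> is close to a geodesic to which \<open>geod_near_walk\<close> applies. Near
  the common corner \<open>H 0\<close> thinness gives only paths from \<open>H 0\<close>, but these can be reversed
  because the two paths form a closed walk.
\<close>

lemma geod_near_opposite_walk:
  assumes w: "walk R w l" and H: "geod R H h" and ends: "H 0 = w l" "H h = w 0"
    and l: "l \<le> 2 ^ n" and i: "i \<le> h"
  shows "\<exists>j\<le>l. near R (\<delta> + spread \<delta> + (triangle_const * n + 1)) (H i) (w j)"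
proof -
  obtain G g where G: "geod R G g" "G 0 = w 0" "G g = w l"
    using ex_geod[OF walk_reachable[OF w, of 0 l]] by auto
  have "(\<exists>j\<le>(0::nat). near R \<delta> (H 0) (H i)) \<or> (\<exists>j\<le>g. near R \<delta> (H i) (G j))"
    by (rule thin[OF H geod_trivial[of R "H 0"] G(1), of "H 0"]) (use G ends i in auto)
  then have "\<exists>j\<le>g. near R (\<delta> + spread \<delta>) (H i) (G j)"
  proof (elim disjE exE conjE)
    fix j assume n: "near R \<delta> (H 0) (H i)"
    have "(H i, H h) \<in> R\<^sup>*" using geod_reachable[OF H] i by simp
    moreover have "(H h, H 0) \<in> R\<^sup>*" using walk_reachable[OF w, of 0 l] ends by simp
    ultimately have "near R (spread \<delta>) (H i) (H 0)" using near_back[OF n] by (meson rtrancl_trans)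
    then show ?thesis using ends G by (auto intro!: exI[of _ g] intro: near_mono)
  qed (meson le_add1 near_mono)
  then obtain j where j: "j \<le> g" "near R (\<delta> + spread \<delta>) (H i) (G j)" by auto
  obtain k where k: "k \<le> l" "near R (triangle_const * n + 1) (G j) (w k)"
    using geod_near_walk[OF w G l j(1)] by auto
  from near_trans[OF j(2) k(2)] k(1) show ?thesis by blast
qed

definition quad_const :: nat where "quad_const = 4 * \<delta> + spread (2 * \<delta>)"

text \<open>
  How far from the ends of the middle side a point must lie for the outer sides, of length at
  most \<open>D\<close>, to be irrelevant for it. It is linear in \<open>D\<close>.
\<close>

definition margin :: "nat \<Rightarrow> nat" where "margin D = spread (D + 4 * \<delta> + spread \<delta>) + 1 + 4 * \<delta>"

text \<open>
  The quadrilateral is split by a geodesic \<open>U\<close> from \<open>x\<close> to \<open>Q n\<close>. In the first triangle a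
  point far from the start of \<open>Q\<close> has a short path to \<open>U\<close>. In the second triangle \<open>U\<close> is tied
  to \<open>H\<close> by paths that arrive at \<open>U\<close>, and \<open>H\<close> to \<open>U\<close> in the same way; starting from a point
  \<open>2 \<delta>\<close> further along \<open>U\<close>, \<open>geod_backtrack\<close> yields a path in the required direction. All other
  alternatives offered by thinness would tie the point to an outer side, and are excluded by
  the margin and the linear ball conditions. The case of a trivial outer side covers points
  near a common end of \<open>Q\<close> and \<open>H\<close>.
\<close>

lemma quadrilateral:
  assumes Q: "geod R Q n" and t: "t \<le> n"
    and x: "near R D x (Q 0)" and y: "near R D (Q n) y"
    and tx: "x = Q 0 \<or> margin D \<le> t" and ty: "y = Q n \<or> margin D \<le> n - t"
  shows "\<exists>H h i. geod R H h \<and> H 0 = x \<and> H h = y \<and> i \<le> h \<and> near R quad_const (Q t) (H i)"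
proof -
  have "\<exists>U u s. geod R U u \<and> U 0 = x \<and> U u = Q n \<and> s \<le> u \<and> near R \<delta> (Q t) (U s)"
  proof (cases "x = Q 0")
    case True
    then show ?thesis using Q t by (intro exI[of _ Q] exI[of _ n] exI[of _ t]) auto
  next
    case False
    then have tD: "margin D \<le> t" using tx by simp
    obtain S s where S: "geod R S s" "S 0 = x" "S s = Q 0"
      using ex_geod[OF near_imp_reachable[OF x]] .
    have "(x, Q n) \<in> R\<^sup>*"
      using near_imp_reachable[OF x] geod_reachable[OF Q, of 0 n] by auto
    then obtain U u where U: "geod R U u" "U 0 = x" "U u = Q n"
      using ex_geod by metis
    have "(\<exists>j\<le>s. near R \<delta> (S j) (Q t)) \<or> (\<exists>j\<le>u. near R \<delta> (Q t) (U j))"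
      by (rule thin[OF Q S(1) U(1), of x]) (use S U t in auto)
    moreover have False if j: "j \<le> s" "near R \<delta> (S j) (Q t)" for j
    proof -
      have "s \<le> D" using geod_length_le[OF S(1)] S x by simp
      then have "near R D (S j) (Q 0)"
        using geod_near[OF S(1) j(1) order_refl] S by (auto intro: near_mono)
      then have "near R (spread (D + \<delta>)) (Q 0) (Q t)"
        using j geod_reachable[OF Q, of 0 t] t by (intro linear_B1[of _ "S j"]) (auto elim: near_mono)
      then have "t \<le> spread (D + \<delta>)" using geodD[OF Q, of 0 t] t by simp
      moreover have "spread (D + \<delta>) < margin D" unfolding margin_def
        using spread_mono[of "D + \<delta>" "D + 4 * \<delta> + spread \<delta>"] by simp
      ultimately show False using tD by simp
    qed
    ultimately show ?thesis using U by blast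
  qed
  then obtain U u s where U: "geod R U u" "U 0 = x" "U u = Q n" and s: "s \<le> u" "near R \<delta> (Q t) (U s)"
    by auto
  show ?thesis
  proof (cases "y = Q n")
    case True
    then show ?thesis using U s near_mono unfolding quad_const_def
      by (intro exI[of _ U] exI[of _ u] exI[of _ s]) (auto elim: near_mono)
  next
    case False
    then have tD: "margin D \<le> n - t" using ty by simp
    obtain E e where E: "geod R E e" "E 0 = Q n" "E e = y"
      using ex_geod[OF near_imp_reachable[OF y]] .
    have eD: "e \<le> D" using geod_length_le[OF E(1)] E y by simp
    have far: False if j: "j \<le> e" "near R (4 * \<delta> + spread \<delta>) (Q t) (E j)" for j
    proof -
      have "near R D (Q n) (E j)"
        using geod_near[OF E(1) le0 j(1)] E eD j by (auto intro: near_mono)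
      then have "near R (spread (D + 4 * \<delta> + spread \<delta>)) (Q t) (Q n)"
        using j geod_reachable[OF Q t] by (intro linear_B2[of _ _ "E j"]) (auto elim: near_mono)
      then have "n \<le> t + spread (D + 4 * \<delta> + spread \<delta>)" by (rule geodD[OF Q t order_refl])
      then show False using tD unfolding margin_def by linarith
    qed
    have xy: "(x, y) \<in> R\<^sup>*"
      using near_imp_reachable[OF y] geod_reachable[OF U(1), of 0 u] U by auto
    then obtain H h where H: "geod R H h" "H 0 = x" "H h = y"
      using ex_geod by metis
    \<comment> \<open>Otherwise \<open>Q t\<close> would be close to the end of \<open>Q\<close>.\<close>
    have su: "s + 2 * \<delta> \<le> u"
    proof (rule ccontr)
      assume "\<not> s + 2 * \<delta> \<le> u"
      then have "near R (2 * \<delta>) (U s) (Q n)"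
        using geod_near[OF U(1) s(1) order_refl] U by (auto intro: near_mono)
      with s(2) have "near R (3 * \<delta>) (Q t) (Q n)" by (elim near_trans_le) auto
      then show False using geodD[OF Q t order_refl] tD unfolding margin_def by fastforce
    qed
    define v where "v = U (s + 2 * \<delta>)"
    have "near R (2 * \<delta>) (U s) v"
      using geod_near[OF U(1), of s "s + 2 * \<delta>"] su unfolding v_def by simp
    with s(2) have tv: "near R (3 * \<delta>) (Q t) v" by (elim near_trans_le) auto
    have "(\<exists>j\<le>h. near R \<delta> (H j) v) \<or> (\<exists>j\<le>e. near R \<delta> v (E j))"
      unfolding v_def by (rule thin[OF U(1) H(1) E(1), of y]) (use H E U su in auto)
    moreover have False if "j \<le> e" "near R \<delta> v (E j)" for j
      by (rule far[OF that(1)]) (use near_trans[OF tv that(2)] in \<open>auto elim: near_mono\<close>)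
    ultimately obtain j where j: "j \<le> h" "near R \<delta> (H j) v" by auto
    have "(\<exists>k\<le>u. near R \<delta> (U k) (H j)) \<or> (\<exists>k\<le>e. near R \<delta> (H j) (E k))"
      by (rule thin[OF H(1) U(1) E(1), of "Q n"]) (use H E U j in auto)
    moreover have False if k: "k \<le> e" "near R \<delta> (H j) (E k)" for k
    proof -
      have "(v, Q n) \<in> R\<^sup>*" using geod_reachable[OF U(1) su order_refl] U unfolding v_def by simp
      moreover have "(Q n, E k) \<in> R\<^sup>*" using geod_reachable[OF E(1) le0 k(1)] E by simp
      ultimately have "near R (spread \<delta>) v (E k)"
        using linear_B1[OF j(2) k(2)] by (meson rtrancl_trans)
      with tv have "near R (3 * \<delta> + spread \<delta>) (Q t) (E k)" by (rule near_trans)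
      then show False by (intro far[OF k(1)]) (auto elim: near_mono)
    qed
    ultimately obtain k where k: "k \<le> u" "near R \<delta> (U k) (H j)" by auto
    have "near R (2 * \<delta>) (U k) (U (s + 2 * \<delta>))"
      using near_trans[OF k(2) j(2)] unfolding v_def by (simp add: mult_2)
    then have "near R (2 * \<delta> + spread (2 * \<delta>)) (U s) (U k)"
      by (intro geod_backtrack[OF U(1) su k(1)])
    with k(2) have "near R (3 * \<delta> + spread (2 * \<delta>)) (U s) (H j)" by (elim near_trans_le) auto
    with s(2) have "near R quad_const (Q t) (H j)" unfolding quad_const_def by (elim near_trans_le) auto
    then show ?thesis using H j by blast
  qed
qed

end

section \<open>Geodesic stability\<close>

definition quasi_geod :: "'a rel \<Rightarrow> nat \<Rightarrow> nat \<Rightarrow> (nat \<Rightarrow> 'a) \<Rightarrow> nat \<Rightarrow> bool" where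
  "quasi_geod R g c w n \<longleftrightarrow> walk R w n \<and>
     (\<forall>i j k. i \<le> j \<longrightarrow> j \<le> n \<longrightarrow> near R k (w i) (w j) \<longrightarrow> j - i \<le> g * k + c)"

lemma quasi_geod_walk: "quasi_geod R g c w n \<Longrightarrow> walk R w n"
  unfolding quasi_geod_def by simp

lemma quasi_geodD:
  "quasi_geod R g c w n \<Longrightarrow> i \<le> j \<Longrightarrow> j \<le> n \<Longrightarrow> near R k (w i) (w j) \<Longrightarrow> j - i \<le> g * k + c"
  unfolding quasi_geod_def by blast

lemma quasi_geod_converse:
  assumes w: "quasi_geod R g c w n" shows "quasi_geod (R\<inverse>) g c (\<lambda>i. w (n - i)) n"
  unfolding quasi_geod_def
proof (intro conjI allI impI)
  show "walk (R\<inverse>) (\<lambda>i. w (n - i)) n"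
    by (rule walk_converse[OF quasi_geod_walk[OF w]])
  fix i j k assume *: "i \<le> j" "j \<le> n" "near (R\<inverse>) k (w (n - i)) (w (n - j))"
  then have "(n - i) - (n - j) \<le> g * k + c"
    by (intro quasi_geodD[OF w]) (auto simp: near_converse)
  then show "j - i \<le> g * k + c" using * by simp
qed

text \<open>
  The choice of scale in the stability theorem: some \<open>n\<close> has \<open>2\<close> to the power \<open>n\<close> above a
  linear function of \<open>D\<close> while a linear function of \<open>n\<close> is still below \<open>D\<close>.
\<close>

lemma exponential_beats_linear:
  fixes a b c d :: nat
  shows "\<exists>N. \<forall>D\<ge>N. \<exists>n. a * D + b \<le> 2 ^ n \<and> c * n + d < D"
proof -
  \<comment> \<open>Chosen so that \<open>a * D + b \<le> s * (n + 1)\<close> when \<open>n\<close> is about \<open>D / (c + 1)\<close>.\<close>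
  define s where "s = a * (c + 1) + a * (c + d + 1) + b"
  have pow: "s * (n + 1) \<le> 2 ^ n" if "2 * s + 4 \<le> n" for n
  proof -
    have *: "k * k \<le> 2 ^ k" if "4 \<le> k" for k :: nat
      using that
    proof (induction k rule: dec_induct)
      case (step k)
      have "Suc k * Suc k \<le> 2 * (k * k)"
      proof -
        have "4 * k \<le> k * k" using step(1) by (rule mult_le_mono1)
        then have "2 * k + 1 \<le> k * k" using step(1) by linarith
        then show ?thesis by simp
      qed
      then show ?case using step by simp
    qed simp
    have "s * (n + 1) \<le> s * (2 * n)" using that by (intro mult_le_mono2) simp
    also have "\<dots> = (2 * s) * n" by simp
    also have "\<dots> \<le> n * n" using that by (intro mult_le_mono1) simp
    also have "\<dots> \<le> 2 ^ n" using * that by simp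
    finally show ?thesis .
  qed
  show ?thesis
  proof (rule exI[of _ "(c + 1) * (2 * s + 4) + (c + d + 1)"], intro allI impI)
    fix D assume D: "(c + 1) * (2 * s + 4) + (c + d + 1) \<le> D"
    define n where "n = (D - (c + d + 1)) div (c + 1)"
    have n: "2 * s + 4 \<le> n"
      unfolding n_def using D by (simp add: less_eq_div_iff_mult_less_eq algebra_simps)
    have lower: "n * (c + 1) \<le> D - (c + d + 1)"
      unfolding n_def by (rule div_times_less_eq_dividend)
    have "D - (c + d + 1) < (n + 1) * (c + 1)"
      unfolding n_def using dividend_less_div_times[of "c + 1" "D - (c + d + 1)"] by (simp add: algebra_simps)
    then have upper: "D \<le> (n + 1) * (c + 1) + (c + d + 1)" using D by simp
    have "a * D + b \<le> a * ((n + 1) * (c + 1) + (c + d + 1)) + b"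
      using upper by (intro add_right_mono mult_le_mono2)
    also have "\<dots> \<le> s * (n + 1)"
      unfolding s_def by (simp add: algebra_simps)
    also have "\<dots> \<le> 2 ^ n" by (rule pow[OF n])
    finally have "a * D + b \<le> 2 ^ n" .
    moreover have "c * n + d < D" using lower D by (simp add: algebra_simps)
    ultimately show "\<exists>n. a * D + b \<le> 2 ^ n \<and> c * n + d < D" by blast
  qed
qed

context thin_relation
begin

text \<open>
  A bound on the length of the piece of a quasi-geodesic that is compared with a geodesic when
  the current estimate for their distance is \<open>D\<close>.
\<close>

definition scale :: "nat \<Rightarrow> nat \<Rightarrow> nat \<Rightarrow> nat" where
  "scale g c D = g * spread (2 * D + 2 * margin D) + c"

text \<open>
  An estimate \<open>D\<close> for the distance in both directions improves to a logarithmic one. Walk from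
  \<open>Q i\<close> a distance \<open>margin D\<close> along \<open>Q\<close> in both directions (or up to an end of \<open>Q\<close>), to \<open>Q s\<close>
  and \<open>Q t\<close>, and connect these to \<open>p\<close> by a path from \<open>p a\<close> to \<open>Q s\<close> and one from \<open>Q t\<close> to
  \<open>p b\<close>. By \<open>quadrilateral\<close>, \<open>Q i\<close> has a short path to a geodesic \<open>H\<close> from \<open>p a\<close> to \<open>p b\<close>, and
  this distance does not depend on \<open>D\<close>. The piece of \<open>p\<close> between \<open>p a\<close> and \<open>p b\<close> has length
  linear in \<open>D\<close>, so \<open>H\<close> is within logarithmic distance of it.
\<close>

lemma morse_step:
  assumes p: "quasi_geod R g c p l" and Q: "geod R Q q" and ends: "Q 0 = p 0" "Q q = p l"
    and out: "\<And>i. i \<le> q \<Longrightarrow> \<exists>j\<le>l. near R D (Q i) (p j)"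
    and inn: "\<And>i. i \<le> q \<Longrightarrow> \<exists>j\<le>l. near R D (p j) (Q i)"
    and n: "scale g c D \<le> 2 ^ n" and i: "i \<le> q"
  shows "\<exists>j\<le>l. near R (triangle_const * n + (quad_const + \<delta> + spread \<delta> + 1)) (Q i) (p j)"
proof -
  define L where "L = margin D"
  have p_walk: "walk R p l" by (rule quasi_geod_walk[OF p])
  \<comment> \<open>At an end of \<open>Q\<close> that is reached too early, \<open>Q\<close> already meets \<open>p\<close>, so that the outer
    side of the quadrilateral is trivial.\<close>
  have "\<exists>s a. s \<le> i \<and> i - s \<le> L \<and> a \<le> l \<and> near R D (p a) (Q s) \<and> (p a = Q s \<or> L \<le> i - s)"
  proof (cases "L \<le> i")
    case True
    have "i - L \<le> q" using i by simp
    then obtain a where "a \<le> l" "near R D (p a) (Q (i - L))" using inn by blast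
    then show ?thesis using True by (intro exI[of _ "i - L"] exI[of _ a]) auto
  next
    case False
    then show ?thesis using ends by (intro exI[of _ 0] exI[of _ "0::nat"]) auto
  qed
  then obtain s a where s: "s \<le> i" "i - s \<le> L" "a \<le> l" "near R D (p a) (Q s)" "p a = Q s \<or> L \<le> i - s"
    by auto
  have "\<exists>t b. i \<le> t \<and> t \<le> q \<and> t - i \<le> L \<and> b \<le> l \<and> near R D (Q t) (p b) \<and> (p b = Q t \<or> L \<le> t - i)"
  proof (cases "i + L \<le> q")
    case True
    obtain b where "b \<le> l" "near R D (Q (i + L)) (p b)" using out[OF True] by auto
    then show ?thesis using True by (intro exI[of _ "i + L"] exI[of _ b]) auto
  next
    case False
    then show ?thesis using ends i by (intro exI[of _ q] exI[of _ l]) auto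
  qed
  then obtain t b where t: "i \<le> t" "t \<le> q" "t - i \<le> L" "b \<le> l" "near R D (Q t) (p b)" "p b = Q t \<or> L \<le> t - i"
    by auto
  have st: "s \<le> t" using s t by simp
  have Q': "geod R (\<lambda>k. Q (s + k)) (t - s)" using geod_sub[OF Q] s t by simp
  have "\<exists>H h j. geod R H h \<and> H 0 = p a \<and> H h = p b \<and> j \<le> h \<and> near R quad_const (Q (s + (i - s))) (H j)"
    by (rule quadrilateral[OF Q', of _ D]) (use s t in \<open>auto simp: L_def\<close>)
  then obtain H h j where H: "geod R H h" "H 0 = p a" "H h = p b" "j \<le> h" "near R quad_const (Q i) (H j)"
    using s by auto
  have "near R (D + (t - s)) (p a) (Q t)"
    using near_trans[OF s(4)] geod_near[OF Q st t(2)] by simp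
  then have ab: "near R (2 * D + 2 * L) (p a) (p b)"
    by (rule near_trans_le[OF _ t(5)]) (use s t in simp)
  \<comment> \<open>The point \<open>p b\<close> may precede \<open>p a\<close> on the quasi-geodesic. In that case the relevant
    piece of \<open>p\<close> runs opposite to \<open>H\<close>, and both ends lie in one strongly connected
    component, which bounds its length.\<close>
  have "\<exists>k\<le>l. near R (\<delta> + spread \<delta> + (triangle_const * n + 1)) (H j) (p k)"
  proof (cases "a \<le> b")
    case True
    have "b - a \<le> g * (2 * D + 2 * L) + c"
      by (rule quasi_geodD[OF p True t(4) ab])
    also have "\<dots> \<le> scale g c D"
      unfolding scale_def L_def by (intro add_right_mono mult_le_mono2 le_spread)
    also note n
    finally have ba: "b - a \<le> 2 ^ n" .
    have "walk R (\<lambda>k. p (a + k)) (b - a)"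
      by (rule walk_sub[OF p_walk True t(4)])
    then have "\<exists>k\<le>b - a. near R (triangle_const * n + 1) (H j) (p (a + k))"
      by (rule geod_near_walk[OF _ H(1)]) (use H ba True in auto)
    then obtain k where "k \<le> b - a" "near R (triangle_const * n + 1) (H j) (p (a + k))" by auto
    then show ?thesis using t(4) True by (intro exI[of _ "a + k"]) (auto elim: near_mono)
  next
    case False
    then have ba: "b \<le> a" by simp
    have "(p b, p a) \<in> R\<^sup>*" by (rule walk_reachable[OF p_walk ba s(3)])
    then have "near R (spread (2 * D + 2 * L)) (p b) (p a)"
      by (rule near_back[OF ab])
    then have "a - b \<le> scale g c D"
      unfolding scale_def L_def by (rule quasi_geodD[OF p ba s(3)])
    also note n
    finally have ab2: "a - b \<le> 2 ^ n" .
    have "walk R (\<lambda>k. p (b + k)) (a - b)"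
      by (rule walk_sub[OF p_walk ba s(3)])
    then have "\<exists>k\<le>a - b. near R (\<delta> + spread \<delta> + (triangle_const * n + 1)) (H j) (p (b + k))"
      by (rule geod_near_opposite_walk[OF _ H(1)]) (use H ab2 ba in auto)
    then obtain k where "k \<le> a - b" "near R (\<delta> + spread \<delta> + (triangle_const * n + 1)) (H j) (p (b + k))" by auto
    then show ?thesis using s(3) ba by (intro exI[of _ "b + k"]) auto
  qed
  then obtain k where "k \<le> l" "near R (\<delta> + spread \<delta> + (triangle_const * n + 1)) (H j) (p k)" by auto
  then show ?thesis
    using near_trans_le[OF H(5)] by (intro exI[of _ k]) auto
qed

lemma scale_linear: "\<exists>a b. \<forall>D. scale g c D = a * D + b"
proof -
  define K where "K = 2 * (f \<delta> + 1)"
  define B where "B = 2 * (K * (4 * \<delta> + spread \<delta> + 1) + 1 + 4 * \<delta>) + 1"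
  have "scale g c D = (g * K * (2 + 2 * K)) * D + (g * (K * B) + c)" for D
    unfolding scale_def margin_def spread_def[of "_ + _ + _"] spread_def[of "_ + _"] K_def[symmetric] B_def
    by (simp add: algebra_simps)
  then show ?thesis by blast
qed

text \<open>
  The least valid estimate \<open>D\<close> cannot be improved by \<open>morse_step\<close>, applied to \<open>R\<close> and to its
  reverse, and hence lies below the threshold where \<open>exponential_beats_linear\<close> sets in.
\<close>

lemma geod_close_to_quasi_geod:
  "\<exists>K. \<forall>p l Q q i. quasi_geod R g c p l \<longrightarrow> geod R Q q \<longrightarrow> Q 0 = p 0 \<longrightarrow> Q q = p l \<longrightarrow> i \<le> q \<longrightarrow>
     (\<exists>j\<le>l. near R K (Q i) (p j)) \<and> (\<exists>j\<le>l. near R K (p j) (Q i))"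
proof -
  obtain a b where ab: "scale g c D = a * D + b" for D
    using scale_linear by blast
  obtain N where N: "\<And>D. N \<le> D \<Longrightarrow> \<exists>n. scale g c D \<le> 2 ^ n \<and> triangle_const * n + (quad_const + \<delta> + spread \<delta> + 1) < D"
    using exponential_beats_linear[of a b triangle_const "quad_const + \<delta> + spread \<delta> + 1"] unfolding ab by blast
  have "(\<exists>j\<le>l. near R N (Q i) (p j)) \<and> (\<exists>j\<le>l. near R N (p j) (Q i))"
    if p: "quasi_geod R g c p l" and Q: "geod R Q q" and ends: "Q 0 = p 0" "Q q = p l" and i: "i \<le> q"
    for p l Q q i
  proof -
    define close where "close D \<longleftrightarrow> (\<forall>i\<le>q. (\<exists>j\<le>l. near R D (Q i) (p j)) \<and> (\<exists>j\<le>l. near R D (p j) (Q i)))" for D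
    have "close q" unfolding close_def
    proof (intro allI impI conjI)
      fix i assume i: "i \<le> q"
      have "near R q (Q i) (p l)" "near R q (p 0) (Q i)"
        using geod_near[OF Q i order_refl] geod_near[OF Q le0 i] i ends by (auto elim: near_mono)
      then show "\<exists>j\<le>l. near R q (Q i) (p j)" "\<exists>j\<le>l. near R q (p j) (Q i)" by auto
    qed
    define D where "D = (LEAST D. close D)"
    have D: "close D" unfolding D_def using \<open>close q\<close> by (rule LeastI)
    have "D < N"
    proof (rule ccontr)
      assume "\<not> D < N"
      then obtain n where n: "scale g c D \<le> 2 ^ n" "triangle_const * n + (quad_const + \<delta> + spread \<delta> + 1) < D"
        using N[of D] by auto
      let ?E = "triangle_const * n + (quad_const + \<delta> + spread \<delta> + 1)"
      interpret C: thin_relation "R\<inverse>" \<delta> f by (rule converse_thin_relation)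
      have out: "\<exists>j\<le>l. near R ?E (Q i) (p j)" if "i \<le> q" for i
        by (rule morse_step[OF p Q ends _ _ n(1) that]) (use D in \<open>auto simp: close_def\<close>)
      have inn: "\<exists>j\<le>l. near R ?E (p j) (Q i)" if i: "i \<le> q" for i
      proof -
        have "\<exists>j\<le>l. near (R\<inverse>) ?E (Q (q - (q - i))) (p (l - j))"
        proof (rule C.morse_step[OF quasi_geod_converse[OF p] geod_converse[OF Q]])
          show "\<exists>j\<le>l. near (R\<inverse>) D (Q (q - i)) (p (l - j))" "\<exists>j\<le>l. near (R\<inverse>) D (p (l - j)) (Q (q - i))" for i
          proof -
            obtain j k where "j \<le> l" "near R D (Q (q - i)) (p j)" "k \<le> l" "near R D (p k) (Q (q - i))"
              using D unfolding close_def by (meson diff_le_self)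
            then show "\<exists>j\<le>l. near (R\<inverse>) D (Q (q - i)) (p (l - j))" "\<exists>j\<le>l. near (R\<inverse>) D (p (l - j)) (Q (q - i))"
              by (simp_all add: near_converse) (metis diff_diff_cancel diff_le_self)+
          qed
        qed (use ends n in auto)
        then show ?thesis using i by (auto simp: near_converse) (meson diff_le_self)
      qed
      have "close ?E" unfolding close_def using out inn by simp
      then have "D \<le> ?E" unfolding D_def by (rule Least_le)
      with n show False by simp
    qed
    then show ?thesis using D i unfolding close_def by (meson near_mono less_imp_le)
  qed
  then show ?thesis by blast
qed

end

section \<open>Limits of geodesics and links between rays\<close>

text \<open>
  The sequence leaves every ball. Unlike the quasi-geodesic condition, this property does not
  depend on the direction in which the sequence is traversed.
\<close>

definition sparse :: "'a rel \<Rightarrow> (nat \<Rightarrow> 'a) \<Rightarrow> bool" where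
  "sparse R X \<longleftrightarrow> (\<forall>k z. finite {i. near R k z (X i)} \<and> finite {i. near R k (X i) z})"

lemma sparse_converse: "sparse (R\<inverse>) X \<longleftrightarrow> sparse R X"
  unfolding sparse_def near_converse by blast

lemma sparse_finite_near:
  fixes X :: "nat \<Rightarrow> 'a"
  assumes "sparse R G" shows "finite {j. \<exists>k<N. near R K (G j) (X k)}"
proof -
  have "finite (\<Union>k<N. {j. near R K (G j) (X k)})"
    by (rule finite_UN_I) (use assms in \<open>auto simp: sparse_def\<close>)
  moreover have "{j. \<exists>k<N. near R K (G j) (X k)} = (\<Union>k<N. {j. near R K (G j) (X k)})" by auto
  ultimately show ?thesis by simp
qed

text \<open>
  The combinatorial content of \<open>ray_le\<close>, without reference to balls.
\<close>

definition linked :: "'a rel \<Rightarrow> nat \<Rightarrow> (nat \<Rightarrow> 'a) \<Rightarrow> (nat \<Rightarrow> 'a) \<Rightarrow> bool" where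
  "linked R M X Y \<longleftrightarrow> (\<forall>N. \<exists>i\<ge>N. \<exists>j\<ge>N. near R M (X i) (Y j))"

lemma linked_converse: "linked (R\<inverse>) M X Y \<longleftrightarrow> linked R M Y X"
  unfolding linked_def near_converse by blast

text \<open>
  Composing paths is immediate since every point of \<open>G\<close> has a short path to \<open>X\<close>. The endpoints
  on \<open>X\<close> move off to infinity because each point of \<open>X\<close> can only be reached by short paths
  from finitely many points of \<open>G\<close>.
\<close>

lemma linked_extend:
  assumes YG: "linked R M Y G" and G: "sparse R G" and GX: "\<And>j. \<exists>k. near R K (G j) (X k)"
  shows "linked R (M + K) Y X"
  unfolding linked_def
proof
  fix N
  obtain N' where N': "\<And>j k. k < N \<Longrightarrow> near R K (G j) (X k) \<Longrightarrow> j < N'"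
    using sparse_finite_near[OF G, of N K X] unfolding finite_nat_set_iff_bounded by blast
  obtain i j where ij: "max N N' \<le> i" "max N N' \<le> j" "near R M (Y i) (G j)"
    using YG unfolding linked_def by meson
  obtain k where k: "near R K (G j) (X k)" using GX by blast
  then have "N \<le> k" using N'[of k j] ij by (meson leD le_trans max.cobounded2 not_le)
  then show "\<exists>i\<ge>N. \<exists>j\<ge>N. near R (M + K) (Y i) (X j)"
    using near_trans[OF ij(3) k] ij by (meson max.boundedE)
qed

lemma linked_coextend:
  assumes "linked R M G Y" "sparse R G" "\<And>j. \<exists>k. near R K (X k) (G j)"
  shows "linked R (M + K) X Y"
proof -
  have "linked (R\<inverse>) (M + K) Y X"
    by (rule linked_extend) (use assms in \<open>auto simp: linked_converse sparse_converse near_converse\<close>)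
  then show ?thesis by (simp add: linked_converse)
qed

context thin_relation
begin

lemma quasi_geod_sparse:
  assumes X: "\<And>n. quasi_geod R g c X n" shows "sparse R X"
  unfolding sparse_def
proof (intro allI conjI)
  fix k z
  have reach: "(X i, X j) \<in> R\<^sup>*" if "i \<le> j" for i j
    by (rule walk_reachable[OF quasi_geod_walk[OF X] that order_refl])
  have *: "j \<le> i + (g * spread k + c)" if "i \<le> j" "near R (spread k) (X i) (X j)" for i j
    using quasi_geodD[OF X that(1) order_refl that(2)] by simp
  show "finite {i. near R k z (X i)}"
    by (rule card_window(2)[of _ "g * spread k + c"]) (auto intro: * linear_B1 reach)
  show "finite {i. near R k (X i) z}"
    by (rule card_window(2)[of _ "g * spread k + c"]) (auto intro: * linear_B2 reach)
qed

text \<open>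
  A limit, in the sense of Koenig's lemma, of geodesics \<open>Q n\<close> from \<open>X 0\<close> to \<open>X n\<close>: their
  lengths are unbounded, so by finiteness of the out-degrees some geodesic ray has all its
  initial segments in common with infinitely many of them. Each point of the ray lies on some
  \<open>Q n\<close> and is therefore uniformly close to \<open>X\<close>.
\<close>

lemma ex_geod_ray:
  assumes fin: "\<And>x. finite {y. (x, y) \<in> R}" and X: "\<And>n. quasi_geod R g c X n"
  shows "\<exists>G K. (\<forall>n. geod R G n) \<and>
    (\<forall>j. (\<exists>k. near R K (G j) (X k)) \<and> (\<exists>k. near R K (X k) (G j)))"
proof -
  have "\<exists>Q d. geod R Q d \<and> Q 0 = X 0 \<and> Q d = X n" for n
    using ex_geod[OF walk_reachable[OF quasi_geod_walk[OF X[of n]] le0 order_refl]] by metis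
  then obtain Q d where Q: "\<And>n. geod R (Q n) (d n)" "\<And>n. Q n 0 = X 0" "\<And>n. Q n (d n) = X n"
    by metis
  have d: "n \<le> g * d n + c" for n
    using quasi_geodD[OF X le0 order_refl, of "d n" n] geod_near[OF Q(1)[of n] le0 order_refl] Q by simp
  \<comment> \<open>The invariant of Koenig's argument. It extends by one index because only finitely many
    of the geodesics are shorter than \<open>m + 1\<close> and because \<open>h m\<close> has finitely many
    successors.\<close>
  define good where "good m h \<longleftrightarrow> infinite {n. m \<le> d n \<and> (\<forall>i\<le>m. Q n i = h i)}" for m and h :: "nat \<Rightarrow> 'a"
  have step: "\<exists>h'. good (Suc m) h' \<and> (\<forall>i\<le>m. h' i = h i)" if "good m h" for m h
  proof -
    define A where "A = {n. m \<le> d n \<and> (\<forall>i\<le>m. Q n i = h i)}"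
    define B where "B = {n \<in> A. Suc m \<le> d n}"
    have "n \<le> g * m + c" if "n \<in> A - B" for n
      using that d[of n] unfolding A_def B_def by (auto simp: not_le dest: le_antisym)
    then have "finite (A - B)" by (metis finite_nat_set_iff_bounded_le)
    moreover have "infinite A" using that unfolding good_def A_def .
    ultimately have B: "infinite B" by (metis Diff_infinite_finite)
    have "(h m, Q n (Suc m)) \<in> R" if "n \<in> B" for n
    proof -
      have "(Q n m, Q n (Suc m)) \<in> R"
        using that geod_walk[OF Q(1)[of n]] unfolding B_def walk_def by auto
      then show ?thesis using that unfolding A_def B_def by auto
    qed
    then have "(\<lambda>n. Q n (Suc m)) ` B \<subseteq> {y. (h m, y) \<in> R}" by auto
    then have "finite ((\<lambda>n. Q n (Suc m)) ` B)" using fin finite_subset by blast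
    then obtain b where b: "infinite {n \<in> B. Q n (Suc m) = Q b (Suc m)}"
      using pigeonhole_infinite[OF B] by blast
    have "{n \<in> B. Q n (Suc m) = Q b (Suc m)} \<subseteq>
        {n. Suc m \<le> d n \<and> (\<forall>i\<le>Suc m. Q n i = (h(Suc m := Q b (Suc m))) i)}"
      unfolding A_def B_def by (auto simp: le_Suc_eq)
    with b have "good (Suc m) (h(Suc m := Q b (Suc m)))"
      unfolding good_def using infinite_super by blast
    then show ?thesis by (intro exI[of _ "h(Suc m := Q b (Suc m))"]) auto
  qed
  have "good 0 (\<lambda>_. X 0)" unfolding good_def using Q by simp
  then obtain H where H: "\<And>m. good m (H m)" "\<And>m i. i \<le> m \<Longrightarrow> H (Suc m) i = H m i"
    using dependent_nat_choice[of good "\<lambda>m h h'. \<forall>i\<le>m. h' i = h i"] step by metis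
  define G where "G i = H i i" for i
  have HG: "H m i = G i" if "i \<le> m" for m i
    using that by (induction m rule: dec_induct) (auto simp: G_def H)
  have G: "\<exists>n. m \<le> d n \<and> (\<forall>i\<le>m. Q n i = G i)" for m
  proof -
    have "{n. m \<le> d n \<and> (\<forall>i\<le>m. Q n i = H m i)} \<noteq> {}"
      using H(1)[of m] unfolding good_def by (metis finite.emptyI)
    then show ?thesis using HG by auto
  qed
  obtain K where K: "\<And>p l Q q i. quasi_geod R g c p l \<Longrightarrow> geod R Q q \<Longrightarrow> Q 0 = p 0 \<Longrightarrow> Q q = p l \<Longrightarrow> i \<le> q \<Longrightarrow>
     (\<exists>j\<le>l. near R K (Q i) (p j)) \<and> (\<exists>j\<le>l. near R K (p j) (Q i))"
    using geod_close_to_quasi_geod by blast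
  show ?thesis
  proof (rule exI[of _ G], rule exI[of _ K], intro conjI allI)
    fix m
    obtain n where n: "m \<le> d n" "\<And>i. i \<le> m \<Longrightarrow> Q n i = G i" using G by blast
    show "geod R G m"
    proof (rule geod_cong)
      show "geod R (Q n) m" using geod_sub[OF Q(1)[of n] le0 n(1)] by simp
    qed (rule n(2))
    have "(\<exists>j\<le>n. near R K (Q n m) (X j)) \<and> (\<exists>j\<le>n. near R K (X j) (Q n m))"
      by (rule K[OF X Q(1) Q(2) Q(3) n(1)])
    then show "\<exists>k. near R K (G m) (X k)" "\<exists>k. near R K (X k) (G m)"
      using n(2)[of m] by auto
  qed
qed

end

section \<open>Digraphs as relations\<close>

lemma hd_map_upt [simp]: "hd (map w [0..<Suc n]) = w 0"
  by (simp add: hd_map del: upt_Suc)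

lemma last_map_upt [simp]: "last (map w [0..<Suc n]) = w n"
  by simp

lemma set_vwalk_arcs_iff:
  "set (vwalk_arcs p) \<subseteq> S \<longleftrightarrow> (\<forall>i<length p - 1. (p ! i, p ! Suc i) \<in> S)"
proof (induction p rule: vwalk_arcs.induct)
  case (3 x y xs)
  then show ?case by (auto simp: less_Suc_eq_0_disj)
qed auto

lemma vwalk_iff_walk:
  "vwalk p D \<longleftrightarrow> p \<noteq> [] \<and> set p \<subseteq> verts D \<and> walk (arcs_ends D) ((!) p) (vwalk_length p)"
  unfolding vwalk_def walk_def set_vwalk_arcs_iff vwalk_length_simp by auto

context wf_digraph begin

lemma arcs_ends_verts: "(x, y) \<in> arcs_ends G \<Longrightarrow> x \<in> verts G \<and> y \<in> verts G"
  by (auto simp: arcs_ends_def arc_to_ends_def)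

text \<open>
  The reflexive pairs outside the vertex set are the only ones that \<open>near\<close> adds to the
  semimetric of the digraph.
\<close>

lemma near_verts:
  assumes "near (arcs_ends G) k x y" shows "x = y \<or> x \<in> verts G \<and> y \<in> verts G"
proof -
  have "(x, y) \<in> (arcs_ends G)\<^sup>*" using assms by (rule near_imp_reachable)
  then have "x = y \<or> (\<exists>u. (x, u) \<in> arcs_ends G)" "x = y \<or> (\<exists>u. (u, y) \<in> arcs_ends G)"
    by (meson converse_rtranclE) (metis \<open>(x, y) \<in> (arcs_ends G)\<^sup>*\<close> rtranclE)
  then show ?thesis using arcs_ends_verts by blast
qed

lemma walk_verts:
  assumes "walk (arcs_ends G) w n" "w 0 \<in> verts G" "i \<le> n" shows "w i \<in> verts G"
  using near_verts[OF walk_near[OF assms(1) le0 assms(3)]] assms(2) by auto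

lemma vwalk_of_walk:
  assumes w: "walk (arcs_ends G) w n" and w0: "w 0 \<in> verts G"
  shows "vwalk (map w [0..<Suc n]) G"
  unfolding vwalk_iff_walk
proof (intro conjI)
  show "set (map w [0..<Suc n]) \<subseteq> verts G"
    using walk_verts[OF w w0] by (auto simp: less_Suc_eq_le)
  show "walk (arcs_ends G) ((!) (map w [0..<Suc n])) (vwalk_length (map w [0..<Suc n]))"
    using w unfolding walk_def by (auto simp del: upt_Suc)
qed simp

lemma ex_vwalk_iff_near:
  "(\<exists>p. vwalk p G \<and> hd p = x \<and> last p = y \<and> vwalk_length p \<le> k) \<longleftrightarrow>
     x \<in> verts G \<and> near (arcs_ends G) k x y"
proof
  assume "\<exists>p. vwalk p G \<and> hd p = x \<and> last p = y \<and> vwalk_length p \<le> k"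
  then obtain p where p: "vwalk p G" "hd p = x" "last p = y" "vwalk_length p \<le> k" by blast
  then have "walk (arcs_ends G) ((!) p) (vwalk_length p)" "p ! 0 = x" "p ! vwalk_length p = y" "x \<in> verts G"
    unfolding vwalk_iff_walk by (auto simp: hd_conv_nth last_conv_nth)
  then show "x \<in> verts G \<and> near (arcs_ends G) k x y"
    unfolding near_iff_walk using p(4) by blast
next
  assume *: "x \<in> verts G \<and> near (arcs_ends G) k x y"
  then obtain w n where w: "walk (arcs_ends G) w n" "n \<le> k" "w 0 = x" "w n = y"
    unfolding near_iff_walk by blast
  then show "\<exists>p. vwalk p G \<and> hd p = x \<and> last p = y \<and> vwalk_length p \<le> k"
    using vwalk_of_walk[OF w(1)] * by (intro exI[of _ "map w [0..<Suc n]"]) (simp del: upt_Suc)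
qed

lemma ddist_le_iff:
  assumes "x \<in> verts G" shows "ddist G x y \<le> enat k \<longleftrightarrow> near (arcs_ends G) k x y"
proof -
  have "ddist G x y \<le> enat k \<longleftrightarrow> ddist G x y < enat (Suc k)"
    by (cases "ddist G x y") auto
  also have "\<dots> \<longleftrightarrow> (\<exists>p. vwalk p G \<and> hd p = x \<and> last p = y \<and> vwalk_length p \<le> k)"
    unfolding ddist_def INF_less_iff by (auto simp: less_Suc_eq_le simp del: vwalk_length_simp)
  finally show ?thesis unfolding ex_vwalk_iff_near using assms by simp
qed

lemma geodesic_map_iff:
  "geodesic G (map w [0..<Suc n]) \<longleftrightarrow> w 0 \<in> verts G \<and> geod (arcs_ends G) w n"
proof
  assume g: "geodesic G (map w [0..<Suc n])"
  then have v: "vwalk (map w [0..<Suc n]) G" and d: "enat n = ddist G (w 0) (w n)"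
    unfolding geodesic_def by (simp_all del: upt_Suc add: hd_map_upt)
  from v have "hd (map w [0..<Suc n]) \<in> verts G" unfolding vwalk_def by (meson hd_in_set subsetD)
  then have w0: "w 0 \<in> verts G" by (simp only: hd_map_upt)
  have "walk (arcs_ends G) w n"
    using v unfolding vwalk_iff_walk walk_def by (auto simp del: upt_Suc)
  moreover have "n \<le> k" if "near (arcs_ends G) k (w 0) (w n)" for k
    using that d unfolding ddist_le_iff[OF w0, symmetric] by (metis enat_ord_simps(1))
  ultimately show "w 0 \<in> verts G \<and> geod (arcs_ends G) w n"
    using w0 shortest_walk_geod by blast
next
  assume w: "w 0 \<in> verts G \<and> geod (arcs_ends G) w n"
  then have "ddist G (w 0) (w n) \<le> enat n"
    using geod_near[of "arcs_ends G" w n 0 n] by (simp add: ddist_le_iff)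
  moreover have "n \<le> k" if "ddist G (w 0) (w n) = enat k" for k
    using that w geod_length_le ddist_le_iff by (metis order_refl)
  ultimately have "enat n = ddist G (w 0) (w n)"
    by (cases "ddist G (w 0) (w n)") (auto intro: antisym)
  then show "geodesic G (map w [0..<Suc n])"
    unfolding geodesic_def using vwalk_of_walk[OF geod_walk] w by (simp del: upt_Suc add: hd_map_upt)
qed

lemma ereal_of_enat_le_iff:
  assumes "0 \<le> r" shows "ereal_of_enat e \<le> ereal r \<longleftrightarrow> e \<le> enat (nat \<lfloor>r\<rfloor>)"
  using assms by (cases e) (auto simp: le_nat_iff le_floor_iff)

lemma out_ball_iff:
  assumes "0 \<le> r" "x \<in> verts G"
  shows "y \<in> out_ball G r x \<longleftrightarrow> near (arcs_ends G) (nat \<lfloor>r\<rfloor>) x y"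
  using assms near_verts[of "nat \<lfloor>r\<rfloor>" x y] unfolding out_ball_def
  by (auto simp: ereal_of_enat_le_iff ddist_le_iff)

lemma in_ball_iff:
  assumes "0 \<le> r" "x \<in> verts G"
  shows "y \<in> in_ball G r x \<longleftrightarrow> near (arcs_ends G) (nat \<lfloor>r\<rfloor>) y x"
  using assms near_verts[of "nat \<lfloor>r\<rfloor>" y x] unfolding in_ball_def
  by (auto simp: ereal_of_enat_le_iff ddist_le_iff)

lemma ddist_bound:
  assumes "ddist G y z = \<infinity> \<or> ereal_of_enat (ddist G y z) \<le> ereal b"
    and "y \<in> verts G" "(y, z) \<in> (arcs_ends G)\<^sup>*"
  shows "near (arcs_ends G) (nat \<lfloor>b\<rfloor>) y z"
proof -
  obtain k where "ddist G y z \<le> enat k"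
    using reachable_imp_near[OF assms(3)] ddist_le_iff[OF assms(2)] by blast
  then have "ddist G y z \<noteq> \<infinity>" using enat_ile by fastforce
  then have b: "ereal_of_enat (ddist G y z) \<le> ereal b" using assms(1) by (elim disjE) simp_all
  have "ereal 0 \<le> ereal_of_enat (ddist G y z)" by (cases "ddist G y z") auto
  with b have "0 \<le> b" using order_trans ereal_less_eq(3) by blast
  then show ?thesis using b assms(2) by (simp add: ereal_of_enat_le_iff ddist_le_iff)
qed

text \<open>
  If \<open>P 0\<close> is not a vertex then \<open>P\<close> is trivial and its single point is an end of \<open>Q\<close>.
  Otherwise all three sides run through vertices and form a geodesic triangle of the digraph.
\<close>

lemma hyperbolic_thin:
  assumes thin: "\<And>A B C. geodesic_triangle G A B C \<Longrightarrow> thin_triangle G \<delta> A B C" and \<delta>: "0 \<le> \<delta>"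
    and P: "geod (arcs_ends G) P p" and Q: "geod (arcs_ends G) Q q" and S: "geod (arcs_ends G) S s"
    and ends: "{Q 0, Q q} = {P 0, z}" "{S 0, S s} = {P p, z}" and i: "i \<le> p"
  shows "(\<exists>j\<le>q. near (arcs_ends G) (nat \<lfloor>\<delta>\<rfloor>) (Q j) (P i)) \<or>
    (\<exists>j\<le>s. near (arcs_ends G) (nat \<lfloor>\<delta>\<rfloor>) (P i) (S j))"
proof (cases "P 0 \<in> verts G")
  case False
  have P0: "near (arcs_ends G) p (P 0) (P p)" using geod_near[OF P le0 order_refl] by simp
  then have "P p = P 0" using near_verts[OF P0] False by simp
  then have "p = 0" using geod_length_le[OF P, of 0] by simp
  then have "P i = Q 0 \<or> P i = Q q" using ends(1) i by auto
  then show ?thesis using near_refl le_refl le0 by metis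
next
  case True
  have ends_verts: "w 0 \<in> verts G \<and> w n \<in> verts G"
    if "geod (arcs_ends G) w n" "w 0 \<in> verts G \<or> w n \<in> verts G" for w n
    using near_verts[OF geod_near[OF that(1) le0 order_refl]] that(2) by auto
  have "P p \<in> verts G" using ends_verts[OF P] True by simp
  have "P 0 = Q 0 \<or> P 0 = Q q" using ends(1) by auto
  then have Qv: "Q 0 \<in> verts G" using ends_verts[OF Q] True by auto
  have "P p = S 0 \<or> P p = S s" using ends(2) by auto
  then have Sv: "S 0 \<in> verts G" using ends_verts[OF S] \<open>P p \<in> verts G\<close> by auto
  let ?A = "map P [0..<Suc p]" and ?B = "map Q [0..<Suc q]" and ?C = "map S [0..<Suc s]"
  have "geodesic_triangle G ?A ?B ?C"
    unfolding geodesic_triangle_def geodesic_map_iff hd_map_upt last_map_upt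
    using P Q S True Qv Sv ends by (intro conjI exI[of _ "P p"] exI[of _ "P 0"] exI[of _ z]) auto
  from thin[OF this, unfolded thin_triangle_def, rule_format, of ?A ?B ?C]
  have sub: "set ?A \<subseteq> (\<Union>q\<in>set ?B. out_ball G \<delta> q) \<union> (\<Union>q\<in>set ?C. in_ball G \<delta> q)"
    using ends by (auto simp del: upt_Suc simp: hd_map_upt)
  have "P i \<in> set ?A" using i by (auto simp: less_Suc_eq_le simp del: upt_Suc)
  with sub consider b where "b \<in> set ?B" "P i \<in> out_ball G \<delta> b" | b where "b \<in> set ?C" "P i \<in> in_ball G \<delta> b"
    by blast
  then show ?thesis
  proof cases
    case 1
    then obtain j where "j \<le> q" "b = Q j" by (auto simp: less_Suc_eq_le simp del: upt_Suc)
    then show ?thesis using 1 out_ball_iff[OF \<delta>] walk_verts[OF geod_walk[OF Q] Qv] by auto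
  next
    case 2
    then obtain j where "j \<le> s" "b = S j" by (auto simp: less_Suc_eq_le simp del: upt_Suc)
    then show ?thesis using 2 in_ball_iff[OF \<delta>] walk_verts[OF geod_walk[OF S] Sv] by auto
  qed
qed

lemma ex_thin_relation:
  assumes "hyperbolic_digraph G" "B1 G" "B2 G"
  shows "\<exists>\<delta> f. thin_relation (arcs_ends G) \<delta> f"
proof -
  obtain \<delta> where \<delta>: "0 \<le> \<delta>" "\<And>A B C. geodesic_triangle G A B C \<Longrightarrow> thin_triangle G \<delta> A B C"
    using assms(1) unfolding hyperbolic_digraph_def by blast
  obtain b where b: "\<And>x r y z. x \<in> verts G \<Longrightarrow> 0 \<le> r \<Longrightarrow> y \<in> out_ball G r x \<Longrightarrow> z \<in> out_ball G r x \<Longrightarrow>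
      ddist G y z = \<infinity> \<or> ereal_of_enat (ddist G y z) \<le> ereal (b r)"
    using assms(2) unfolding B1_def by blast
  obtain c where c: "\<And>x r y z. x \<in> verts G \<Longrightarrow> 0 \<le> r \<Longrightarrow> y \<in> in_ball G r x \<Longrightarrow> z \<in> in_ball G r x \<Longrightarrow>
      ddist G y z = \<infinity> \<or> ereal_of_enat (ddist G y z) \<le> ereal (c r)"
    using assms(3) unfolding B2_def by blast
  define f where "f k = nat \<lfloor>b (real k)\<rfloor> + nat \<lfloor>c (real k)\<rfloor>" for k
  have "thin_relation (arcs_ends G) (nat \<lfloor>\<delta>\<rfloor>) f"
  proof
    fix r x y z
    assume *: "near (arcs_ends G) r x y" "near (arcs_ends G) r x z" "(y, z) \<in> (arcs_ends G)\<^sup>*"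
    show "near (arcs_ends G) (f r) y z"
    proof (cases "x \<in> verts G")
      case True
      then have "near (arcs_ends G) (nat \<lfloor>b (real r)\<rfloor>) y z"
        using * near_verts[OF *(1)] by (intro ddist_bound b[of x "real r"]) (auto simp: out_ball_iff)
      then show ?thesis unfolding f_def by (auto elim: near_mono)
    next
      case False
      then show ?thesis using near_verts[OF *(1)] near_verts[OF *(2)] by auto
    qed
  next
    fix r x y z
    assume *: "near (arcs_ends G) r y x" "near (arcs_ends G) r z x" "(y, z) \<in> (arcs_ends G)\<^sup>*"
    show "near (arcs_ends G) (f r) y z"
    proof (cases "x \<in> verts G")
      case True
      then have "near (arcs_ends G) (nat \<lfloor>c (real r)\<rfloor>) y z"
        using * near_verts[OF *(1)] by (intro ddist_bound c[of x "real r"]) (auto simp: in_ball_iff)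
      then show ?thesis unfolding f_def by (auto elim: near_mono)
    next
      case False
      then show ?thesis using near_verts[OF *(1)] near_verts[OF *(2)] by auto
    qed
  qed (rule hyperbolic_thin[OF \<delta>(2) \<delta>(1)])
  then show ?thesis by blast
qed

lemma finite_successors:
  assumes "finite_out_degrees G" shows "finite {y. (x, y) \<in> arcs_ends G}"
proof (cases "x \<in> verts G")
  case True
  have "{y. (x, y) \<in> arcs_ends G} \<subseteq> insert x {y \<in> verts G. ddist G x y = 1}"
  proof
    fix y assume "y \<in> {y. (x, y) \<in> arcs_ends G}"
    then have xy: "(x, y) \<in> arcs_ends G" by simp
    then have "near (arcs_ends G) 1 x y" unfolding near_def by (intro exI[of _ 1]) simp
    then have "ddist G x y \<le> enat 1" using ddist_le_iff[OF True] by blast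
    then have "ddist G x y = 1 \<or> ddist G x y \<le> enat 0"
      by (cases "ddist G x y") (auto simp: one_enat_def le_Suc_eq)
    then show "y \<in> insert x {y \<in> verts G. ddist G x y = 1}"
      using arcs_ends_verts[OF xy] ddist_le_iff[OF True, of y 0] by (auto simp: near_0)
  qed
  then show ?thesis using assms True unfolding finite_out_degrees_def
    by (meson finite_insert finite_subset)
next
  case False
  then have "{y. (x, y) \<in> arcs_ends G} = {}" using arcs_ends_verts by blast
  then show ?thesis by simp
qed

lemma finite_predecessors:
  assumes "finite_in_degrees G" shows "finite {y. (y, x) \<in> arcs_ends G}"
proof (cases "x \<in> verts G")
  case True
  have "{y. (y, x) \<in> arcs_ends G} \<subseteq> insert x {y \<in> verts G. ddist G y x = 1}"
  proof
    fix y assume "y \<in> {y. (y, x) \<in> arcs_ends G}"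
    then have xy: "(y, x) \<in> arcs_ends G" by simp
    then have y: "y \<in> verts G" using arcs_ends_verts by blast
    have "near (arcs_ends G) 1 y x" unfolding near_def using xy by (intro exI[of _ 1]) simp
    then have "ddist G y x \<le> enat 1" using ddist_le_iff[OF y] by blast
    then have "ddist G y x = 1 \<or> ddist G y x \<le> enat 0"
      by (cases "ddist G y x") (auto simp: one_enat_def le_Suc_eq)
    then show "y \<in> insert x {y \<in> verts G. ddist G y x = 1}"
      using y ddist_le_iff[OF y, of x 0] by (auto simp: near_0)
  qed
  then show ?thesis using assms True unfolding finite_in_degrees_def
    by (meson finite_insert finite_subset)
next
  case False
  then have "{y. (y, x) \<in> arcs_ends G} = {}" using arcs_ends_verts by blast
  then show ?thesis by simp
qed

end

section \<open>Boundary points\<close>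

text \<open>
  The class \<open>\<eta>\<close> of \<open>X\<close> in \<open>S\<close> contains the class in \<open>T\<close> of a close \<open>G\<close>: if \<open>Y\<close> is equivalent
  to \<open>G\<close>, then paths between \<open>Y\<close> and \<open>G\<close> can be prolonged to \<open>X\<close>, in both directions.
\<close>

lemma boundary_points_contain:
  assumes sub: "T \<subseteq> S"
    and link: "\<And>X Y. X \<in> S \<Longrightarrow> Y \<in> S \<Longrightarrow> ray_le D X Y \<longleftrightarrow> (\<exists>M. linked R M X Y)"
    and sparse: "\<And>X. X \<in> S \<Longrightarrow> sparse R X"
    and close: "\<And>X. X \<in> S \<Longrightarrow> \<exists>G\<in>T. \<exists>K. \<forall>j. (\<exists>k. near R K (G j) (X k)) \<and> (\<exists>k. near R K (X k) (G j))"
  shows "\<forall>\<eta>\<in>boundary_points_of D S. \<exists>\<zeta>\<in>boundary_points_of D T. \<zeta> \<subseteq> \<eta>"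
proof
  fix \<eta> assume "\<eta> \<in> boundary_points_of D S"
  then obtain X where X: "X \<in> S" and \<eta>: "\<eta> = ray_equiv_on D S `` {X}"
    unfolding boundary_points_of_def by (auto elim: quotientE)
  obtain G K where G: "G \<in> T" and GX: "\<And>j. \<exists>k. near R K (G j) (X k)" "\<And>j. \<exists>k. near R K (X k) (G j)"
    using close[OF X] by blast
  have GS: "G \<in> S" using G sub by blast
  have "ray_equiv_on D T `` {G} \<subseteq> \<eta>"
  proof
    fix Y assume "Y \<in> ray_equiv_on D T `` {G}"
    then have Y: "Y \<in> S" and GY: "ray_le D G Y" and YG: "ray_le D Y G"
      using sub unfolding ray_equiv_on_def by auto
    obtain M where "linked R M G Y" using GY link[OF GS Y] by blast
    then have "linked R (M + K) X Y" using GX(2) by (rule linked_coextend[OF _ sparse[OF GS]])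
    then have "ray_le D X Y" using link[OF X Y] by blast
    moreover obtain N where "linked R N Y G" using YG link[OF Y GS] by blast
    then have "linked R (N + K) Y X" using GX(1) by (rule linked_extend[OF _ sparse[OF GS]])
    then have "ray_le D Y X" using link[OF Y X] by blast
    ultimately show "Y \<in> \<eta>" unfolding \<eta> ray_equiv_on_def using X Y by simp
  qed
  moreover have "ray_equiv_on D T `` {G} \<in> boundary_points_of D T"
    unfolding boundary_points_of_def using G by (rule quotientI)
  ultimately show "\<exists>\<zeta>\<in>boundary_points_of D T. \<zeta> \<subseteq> \<eta>" by blast
qed

lemma segment_eq: "i \<le> j \<Longrightarrow> segment X i j = map (\<lambda>k. X (i + k)) [0..<Suc (j - i)]"
  unfolding segment_def by (rule nth_equalityI) (auto simp del: upt_Suc)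

lemma rev_segment_eq: "i \<le> j \<Longrightarrow> rev (segment X i j) = map (\<lambda>k. X (j - k)) [0..<Suc (j - i)]"
  unfolding segment_def by (rule nth_equalityI) (auto simp del: upt_Suc simp: rev_nth)

lemma list_eq_map_nth: "p \<noteq> [] \<Longrightarrow> p = map ((!) p) [0..<Suc (vwalk_length p)]"
  by (rule nth_equalityI) (auto simp del: upt_Suc)

context wf_digraph begin

text \<open>
  A ball around \<open>X 0\<close> of radius \<open>L\<close> contains the first \<open>L\<close> points of \<open>X\<close>, so paths that avoid
  it start late on \<open>X\<close>; as \<open>X\<close> is sparse, they then end late on \<open>Y\<close>. Conversely, if a short
  path from \<open>X i\<close> to \<open>Y j\<close> meets an out-ball, then \<open>Y j\<close> is in a slightly larger out-ball, and
  if it meets an in-ball, then \<open>X i\<close> is in a slightly larger in-ball; both fail for large \<open>i\<close>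
  and \<open>j\<close>.
\<close>

lemma ray_le_iff_linked:
  assumes X: "range X \<subseteq> verts G" "sparse (arcs_ends G) X"
    and root: "(\<forall>i. near (arcs_ends G) i (X 0) (X i)) \<or> (\<forall>i. near (arcs_ends G) i (X i) (X 0))"
    and Y: "sparse (arcs_ends G) Y"
  shows "ray_le G X Y \<longleftrightarrow> (\<exists>M. linked (arcs_ends G) M X Y)"
proof
  assume "ray_le G X Y"
  then obtain M where M: "0 \<le> M" "\<And>r x. 0 \<le> r \<Longrightarrow> x \<in> verts G \<Longrightarrow>
      \<exists>p. vwalk p G \<and> hd p \<in> range X \<and> last p \<in> range Y \<and> real (vwalk_length p) \<le> M \<and>
            set p \<inter> (out_ball G r x \<union> in_ball G r x) = {}"
    unfolding ray_le_def by blast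
  define K where "K = nat \<lfloor>M\<rfloor>"
  have "\<exists>i\<ge>N. \<exists>j\<ge>N. near (arcs_ends G) K (X i) (Y j)" for N
  proof -
    obtain N' where N': "\<And>i j. j < N \<Longrightarrow> near (arcs_ends G) K (X i) (Y j) \<Longrightarrow> i < N'"
      using sparse_finite_near[OF X(2), of N K Y] unfolding finite_nat_set_iff_bounded by blast
    define L where "L = max N N'"
    have X0: "X 0 \<in> verts G" using X(1) by auto
    obtain p i j where p: "vwalk p G" "hd p = X i" "last p = Y j" "real (vwalk_length p) \<le> M"
        "set p \<inter> (out_ball G (real L) (X 0) \<union> in_ball G (real L) (X 0)) = {}"
      using M(2)[of "real L" "X 0"] X0 by auto
    have "vwalk_length p \<le> K" unfolding K_def using p(4) by (simp add: le_nat_floor)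
    then have ij: "near (arcs_ends G) K (X i) (Y j)"
      using ex_vwalk_iff_near[of "X i" "Y j" K] p by blast
    have "L \<le> i"
    proof (rule ccontr)
      assume "\<not> L \<le> i"
      then have "near (arcs_ends G) L (X 0) (X i) \<or> near (arcs_ends G) L (X i) (X 0)"
        using root near_mono by (meson less_imp_le not_le)
      then have "X i \<in> out_ball G (real L) (X 0) \<union> in_ball G (real L) (X 0)"
        using X0 by (simp add: out_ball_iff in_ball_iff)
      moreover have "X i \<in> set p" using p(1,2) unfolding vwalk_def by (metis hd_in_set)
      ultimately show False using p(5) by blast
    qed
    then have "N \<le> i" "N \<le> j" using N'[OF _ ij] unfolding L_def by (auto simp: not_less[symmetric])
    then show ?thesis using ij by blast
  qed
  then show "\<exists>M. linked (arcs_ends G) M X Y" unfolding linked_def by blast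
next
  assume "\<exists>M. linked (arcs_ends G) M X Y"
  then obtain M where M: "linked (arcs_ends G) M X Y" by blast
  show "ray_le G X Y"
    unfolding ray_le_def
  proof (intro exI[of _ "real M"] conjI allI impI ballI)
    fix r :: real and x assume r: "0 \<le> r" and x: "x \<in> verts G"
    define k where "k = nat \<lfloor>r\<rfloor>"
    have "finite ({j. near (arcs_ends G) (k + M) x (Y j)} \<union> {i. near (arcs_ends G) (M + k) (X i) x})"
      using X(2) Y unfolding sparse_def by blast
    then obtain N where N: "\<And>j. near (arcs_ends G) (k + M) x (Y j) \<Longrightarrow> j < N"
        "\<And>i. near (arcs_ends G) (M + k) (X i) x \<Longrightarrow> i < N"
      unfolding finite_nat_set_iff_bounded by blast
    obtain i j where ij: "N \<le> i" "N \<le> j" "near (arcs_ends G) M (X i) (Y j)"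
      using M unfolding linked_def by blast
    then obtain p where p: "vwalk p G" "hd p = X i" "last p = Y j" "vwalk_length p \<le> M"
      using ex_vwalk_iff_near[of "X i" "Y j" M] X(1) by blast
    have False if u: "u \<in> set p" "u \<in> out_ball G r x \<union> in_ball G r x" for u
    proof -
      have w: "walk (arcs_ends G) ((!) p) (vwalk_length p)" and ne: "p \<noteq> []"
        using p(1) unfolding vwalk_iff_walk by auto
      obtain m where m: "m \<le> vwalk_length p" "u = p ! m"
        using u(1) ne by (auto simp: in_set_conv_nth) (metis Suc_pred length_greater_0_conv less_Suc_eq_le)
      have "near (arcs_ends G) M (X i) u"
        using walk_near[OF w le0 m(1)] m p ne by (auto simp: hd_conv_nth elim: near_mono)
      moreover have "near (arcs_ends G) M u (Y j)"
        using walk_near[OF w m(1) order_refl] m p ne by (auto simp: last_conv_nth elim: near_mono)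
      moreover have "near (arcs_ends G) k x u \<or> near (arcs_ends G) k u x"
        using u(2) out_ball_iff[OF r x] in_ball_iff[OF r x] unfolding k_def by blast
      ultimately have "near (arcs_ends G) (k + M) x (Y j) \<or> near (arcs_ends G) (M + k) (X i) x"
        using near_trans by metis
      then show False using N ij by (meson not_le)
    qed
    then have "set p \<inter> (out_ball G r x \<union> in_ball G r x) = {}" by blast
    then show "\<exists>p. vwalk p G \<and> hd p \<in> range X \<and> last p \<in> range Y \<and> real (vwalk_length p) \<le> real M \<and>
            set p \<inter> (out_ball G r x \<union> in_ball G r x) = {}"
      using p by (metis of_nat_le_iff rangeI)
  qed simp
qed

lemma quasi_geodesic_length:
  assumes q: "quasi_geodesic G \<gamma> c p" and "1 \<le> \<gamma>" "0 \<le> c" and n: "near (arcs_ends G) k (hd p) (last p)"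
  shows "vwalk_length p \<le> nat \<lceil>\<gamma>\<rceil> * k + nat \<lceil>c\<rceil>"
proof -
  have p: "p \<noteq> []" "hd p \<in> verts G" using q unfolding quasi_geodesic_def vwalk_def by auto
  have "ddist G (hd p) (last p) \<le> enat k" using n ddist_le_iff[OF p(2)] by blast
  then obtain m where m: "ddist G (hd p) (last p) = enat m" "m \<le> k" by (cases "ddist G (hd p) (last p)") auto
  have "ereal (real (vwalk_length p)) \<le> ereal \<gamma> * ereal_of_enat (ddist G (hd p) (last p)) + ereal c"
    using q p unfolding quasi_geodesic_def by blast
  then have "real (vwalk_length p) \<le> \<gamma> * real m + c" by (simp add: m)
  also have "\<dots> \<le> real (nat \<lceil>\<gamma>\<rceil>) * real k + real (nat \<lceil>c\<rceil>)"
    using assms m by (intro add_mono mult_mono) (auto simp: real_nat_ceiling_ge)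
  finally have "real (vwalk_length p) \<le> real (nat \<lceil>\<gamma>\<rceil> * k + nat \<lceil>c\<rceil>)" by simp
  then show ?thesis by (simp only: of_nat_le_iff)
qed

lemma quasi_geodesic_ray_quasi_geod:
  assumes "quasi_geodesic_ray G X" shows "\<exists>g c. \<forall>n. quasi_geod (arcs_ends G) g c X n"
proof -
  obtain \<gamma> c where \<gamma>: "1 \<le> \<gamma>" "0 \<le> c" and q: "\<And>i j. i \<le> j \<Longrightarrow> quasi_geodesic G \<gamma> c (segment X i j)"
    using assms unfolding quasi_geodesic_ray_def by blast
  have "j - i \<le> nat \<lceil>\<gamma>\<rceil> * k + nat \<lceil>c\<rceil>" if "i \<le> j" "near (arcs_ends G) k (X i) (X j)" for i j k
    using quasi_geodesic_length[OF q[OF that(1)] \<gamma>, of k] that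
    by (simp add: segment_eq hd_map_upt last_map_upt del: upt_Suc)
  moreover have "walk (arcs_ends G) X n" for n
    using assms unfolding quasi_geodesic_ray_def ray_def walk_def by blast
  ultimately show ?thesis unfolding quasi_geod_def by blast
qed

lemma quasi_geodesic_anti_ray_quasi_geod:
  assumes "quasi_geodesic_anti_ray G X" shows "\<exists>g c. \<forall>n. quasi_geod ((arcs_ends G)\<inverse>) g c X n"
proof -
  obtain \<gamma> c where \<gamma>: "1 \<le> \<gamma>" "0 \<le> c" and q: "\<And>i j. i \<le> j \<Longrightarrow> quasi_geodesic G \<gamma> c (rev (segment X i j))"
    using assms unfolding quasi_geodesic_anti_ray_def by blast
  have "j - i \<le> nat \<lceil>\<gamma>\<rceil> * k + nat \<lceil>c\<rceil>" if "i \<le> j" "near ((arcs_ends G)\<inverse>) k (X i) (X j)" for i j k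
    using quasi_geodesic_length[OF q[OF that(1)] \<gamma>, of k] that
    by (simp add: rev_segment_eq near_converse hd_map_upt last_map_upt del: upt_Suc)
  moreover have "walk ((arcs_ends G)\<inverse>) X n" for n
    using assms unfolding quasi_geodesic_anti_ray_def anti_ray_def walk_def by blast
  ultimately show ?thesis unfolding quasi_geod_def by blast
qed

lemma geodesic_imp_quasi_geodesic:
  assumes p: "geodesic G p" shows "quasi_geodesic G 1 0 p"
  unfolding quasi_geodesic_def
proof (intro conjI allI impI)
  show v: "vwalk p G" using p unfolding geodesic_def by blast
  then have ne: "p \<noteq> []" unfolding vwalk_def by blast
  have "geodesic G (map ((!) p) [0..<Suc (vwalk_length p)])"
    using p list_eq_map_nth[OF ne] by simp
  then have g: "p ! 0 \<in> verts G" "geod (arcs_ends G) ((!) p) (vwalk_length p)"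
    unfolding geodesic_map_iff by auto
  fix q assume "sublist q p \<and> q \<noteq> []"
  then obtain a b where q: "p = a @ q @ b" "q \<noteq> []" unfolding sublist_def by auto
  have len: "length a + vwalk_length q \<le> vwalk_length p" using q by (cases q) auto
  have eq: "q = map (\<lambda>k. p ! (length a + k)) [0..<Suc (vwalk_length q)]"
    by (rule nth_equalityI) (use q in \<open>auto simp del: upt_Suc simp: nth_append\<close>)
  have "geod (arcs_ends G) (\<lambda>k. p ! (length a + k)) (vwalk_length q)"
    using geod_sub[OF g(2), of "length a" "length a + vwalk_length q"] len by simp
  moreover have "p ! (length a + 0) \<in> verts G"
    using v q unfolding vwalk_def by (auto simp: nth_append)
  ultimately have "geodesic G q"
    by (subst eq) (auto simp: geodesic_map_iff simp del: upt_Suc)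
  then have "ddist G (hd q) (last q) = enat (vwalk_length q)" unfolding geodesic_def by simp
  then show "ereal (real (vwalk_length q)) \<le> ereal 1 * ereal_of_enat (ddist G (hd q) (last q)) + ereal 0"
    by simp
qed

lemma geodesic_ray_imp_quasi: "geodesic_ray G X \<Longrightarrow> quasi_geodesic_ray G X"
  unfolding geodesic_ray_def quasi_geodesic_ray_def
  using geodesic_imp_quasi_geodesic by (meson order_refl)

lemma geodesic_anti_ray_imp_quasi: "geodesic_anti_ray G X \<Longrightarrow> quasi_geodesic_anti_ray G X"
  unfolding geodesic_anti_ray_def quasi_geodesic_anti_ray_def
  using geodesic_imp_quasi_geodesic by (meson order_refl)

lemma geodesic_rayI:
  assumes g: "\<And>n. geod (arcs_ends G) X n" shows "geodesic_ray G X"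
proof -
  have step: "(X i, X (Suc i)) \<in> arcs_ends G" for i
    using geod_walk[OF g[of "Suc i"]] unfolding walk_def by blast
  then have v: "X i \<in> verts G" for i using arcs_ends_verts by blast
  have "geodesic G (segment X i j)" if "i \<le> j" for i j
    unfolding segment_eq[OF that] geodesic_map_iff using v geod_sub[OF g that order_refl] by simp
  then show ?thesis unfolding geodesic_ray_def ray_def using geod_inj[OF g] step v by blast
qed

lemma geodesic_anti_rayI:
  assumes g: "\<And>n. geod ((arcs_ends G)\<inverse>) X n" shows "geodesic_anti_ray G X"
proof -
  have step: "(X (Suc i), X i) \<in> arcs_ends G" for i
    using geod_walk[OF g[of "Suc i"]] unfolding walk_def by blast
  then have v: "X i \<in> verts G" for i using arcs_ends_verts by blast
  have "geodesic G (rev (segment X i j))" if "i \<le> j" for i j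
    unfolding rev_segment_eq[OF that] geodesic_map_iff
    using v geod_sub[OF geod_converse[OF g[of j]], of 0 "j - i"] by simp
  then show ?thesis unfolding geodesic_anti_ray_def anti_ray_def using geod_inj[OF g] step v by blast
qed

end

locale thin_digraph = wf_digraph G + thin_relation "arcs_ends G" \<delta> f
  for G :: "('a, 'b) pre_digraph" and \<delta> f
begin

lemma quasi_geodesic_ray_sparse:
  assumes "quasi_geodesic_ray G X \<or> quasi_geodesic_anti_ray G X" shows "sparse (arcs_ends G) X"
  using assms
proof
  assume "quasi_geodesic_ray G X"
  then show ?thesis using quasi_geodesic_ray_quasi_geod quasi_geod_sparse by blast
next
  interpret C: thin_relation "(arcs_ends G)\<inverse>" \<delta> f by (rule converse_thin_relation)
  assume "quasi_geodesic_anti_ray G X"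
  then have "sparse ((arcs_ends G)\<inverse>) X"
    using quasi_geodesic_anti_ray_quasi_geod C.quasi_geod_sparse by blast
  then show ?thesis by (simp add: sparse_converse)
qed

lemma quasi_geodesic_ray_le_iff_linked:
  assumes X: "quasi_geodesic_ray G X \<or> quasi_geodesic_anti_ray G X"
    and Y: "quasi_geodesic_ray G Y \<or> quasi_geodesic_anti_ray G Y"
  shows "ray_le G X Y \<longleftrightarrow> (\<exists>M. linked (arcs_ends G) M X Y)"
proof (rule ray_le_iff_linked)
  show "range X \<subseteq> verts G"
    using X unfolding quasi_geodesic_ray_def quasi_geodesic_anti_ray_def ray_def anti_ray_def by blast
  show "(\<forall>i. near (arcs_ends G) i (X 0) (X i)) \<or> (\<forall>i. near (arcs_ends G) i (X i) (X 0))"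
    using X
  proof
    assume "quasi_geodesic_ray G X"
    then have "walk (arcs_ends G) X i" for i
      unfolding quasi_geodesic_ray_def ray_def walk_def by blast
    from walk_near[OF this le0 order_refl] show ?thesis by simp
  next
    assume "quasi_geodesic_anti_ray G X"
    then have "walk ((arcs_ends G)\<inverse>) X i" for i
      unfolding quasi_geodesic_anti_ray_def anti_ray_def walk_def by blast
    from walk_near[OF this le0 order_refl] show ?thesis by (simp add: near_converse)
  qed
qed (use X Y quasi_geodesic_ray_sparse in auto)

lemma ex_geodesic_ray_close:
  assumes "finite_out_degrees G" "quasi_geodesic_ray G X"
  shows "\<exists>H. geodesic_ray G H \<and>
    (\<exists>K. \<forall>j. (\<exists>k. near (arcs_ends G) K (H j) (X k)) \<and> (\<exists>k. near (arcs_ends G) K (X k) (H j)))"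
proof -
  obtain g c where "\<And>n. quasi_geod (arcs_ends G) g c X n"
    using quasi_geodesic_ray_quasi_geod[OF assms(2)] by blast
  from ex_geod_ray[OF finite_successors[OF assms(1)] this] show ?thesis
    using geodesic_rayI by blast
qed

lemma ex_geodesic_anti_ray_close:
  assumes "finite_in_degrees G" "quasi_geodesic_anti_ray G X"
  shows "\<exists>H. geodesic_anti_ray G H \<and>
    (\<exists>K. \<forall>j. (\<exists>k. near (arcs_ends G) K (H j) (X k)) \<and> (\<exists>k. near (arcs_ends G) K (X k) (H j)))"
proof -
  interpret C: thin_relation "(arcs_ends G)\<inverse>" \<delta> f by (rule converse_thin_relation)
  obtain g c where "\<And>n. quasi_geod ((arcs_ends G)\<inverse>) g c X n"
    using quasi_geodesic_anti_ray_quasi_geod[OF assms(2)] by blast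
  from C.ex_geod_ray[OF _ this] show ?thesis
    using geodesic_anti_rayI finite_predecessors[OF assms(1)] by (auto simp: near_converse) blast
qed

end

theorem proposition5p3:
  fixes D :: "('a, 'b) pre_digraph"
  assumes "wf_digraph D"
    and "hyperbolic_digraph D"
    and "B1 D"
    and "B2 D"
  shows "(finite_out_degrees D \<longrightarrow>
           (\<forall>\<eta>\<in>quasi_geodesic_f_boundary D. \<exists>\<zeta>\<in>geodesic_f_boundary D. \<zeta> \<subseteq> \<eta>)) \<and>
         (finite_in_degrees D \<longrightarrow>
           (\<forall>\<eta>\<in>quasi_geodesic_b_boundary D. \<exists>\<zeta>\<in>geodesic_b_boundary D. \<zeta> \<subseteq> \<eta>)) \<and>
         (locally_finite_digraph D \<longrightarrow>
           (\<forall>\<eta>\<in>quasi_geodesic_boundary D. \<exists>\<zeta>\<in>geodesic_boundary D. \<zeta> \<subseteq> \<eta>))"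
proof -
  interpret wf_digraph D by fact
  obtain \<delta> f where "thin_relation (arcs_ends D) \<delta> f"
    using ex_thin_relation assms by blast
  then interpret thin_digraph D \<delta> f by (simp add: thin_digraph_def assms(1))
  note quasi = geodesic_ray_imp_quasi geodesic_anti_ray_imp_quasi
  note facts = quasi_geodesic_ray_le_iff_linked quasi_geodesic_ray_sparse
  show ?thesis
    unfolding quasi_geodesic_f_boundary_def geodesic_f_boundary_def quasi_geodesic_b_boundary_def
      geodesic_b_boundary_def quasi_geodesic_boundary_def geodesic_boundary_def locally_finite_digraph_def
  proof (intro conjI impI)
    assume "finite_out_degrees D"
    then show "\<forall>\<eta>\<in>boundary_points_of D {X. quasi_geodesic_ray D X}.
        \<exists>\<zeta>\<in>boundary_points_of D {X. geodesic_ray D X}. \<zeta> \<subseteq> \<eta>"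
      using quasi facts ex_geodesic_ray_close
      by (intro boundary_points_contain[where R = "arcs_ends D"]) auto
  next
    assume "finite_in_degrees D"
    then show "\<forall>\<eta>\<in>boundary_points_of D {X. quasi_geodesic_anti_ray D X}.
        \<exists>\<zeta>\<in>boundary_points_of D {X. geodesic_anti_ray D X}. \<zeta> \<subseteq> \<eta>"
      using quasi facts ex_geodesic_anti_ray_close
      by (intro boundary_points_contain[where R = "arcs_ends D"]) auto
  next
    assume fin: "finite_out_degrees D \<and> finite_in_degrees D"
    show "\<forall>\<eta>\<in>boundary_points_of D {X. quasi_geodesic_ray D X \<or> quasi_geodesic_anti_ray D X}.
        \<exists>\<zeta>\<in>boundary_points_of D {X. geodesic_ray D X \<or> geodesic_anti_ray D X}. \<zeta> \<subseteq> \<eta>"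
    proof (rule boundary_points_contain[where R = "arcs_ends D"])
      fix X assume "X \<in> {X. quasi_geodesic_ray D X \<or> quasi_geodesic_anti_ray D X}"
      then show "\<exists>G\<in>{X. geodesic_ray D X \<or> geodesic_anti_ray D X}. \<exists>K. \<forall>j.
          (\<exists>k. near (arcs_ends D) K (G j) (X k)) \<and> (\<exists>k. near (arcs_ends D) K (X k) (G j))"
        using ex_geodesic_ray_close ex_geodesic_anti_ray_close fin by blast
    qed (use quasi facts in auto)
  qed
qed

end
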